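(* Let $G$ be a finite group. If $G$ is weakly semi-nilpotent, then: (i) $G$ has a complete set of Sylow subgroups $\{P_1,\ldots,P_t\}$ such that for some $1\le r\le t$ the subgroups $P_1,\ldots,P_r$ are normal in $G$, $P_i$ is not normal in $G$ for all $i>r$, and $\langle P_{r+1},\ldots,P_t\rangle=P_{r+1}\times\cdots\times P_t$. (ii) $F(G)$ is a maximal nilpotent subgroup of $G$ and $F(G)=F_{0\sigma}(G)Z_\infty(G)$, where $F_{0\sigma}(G)=P_1\cdots P_r$. (iii) If $G$ is not nilpotent, then $N_G(P_i)$ is a Carter subgroup of $G$ for all $i>r$.
   Context: All groups are finite. $G$ is weakly semi-nilpotent if the normalizer $N_G(A)$ of every non-subnormal nilpotent subgroup $A$ of $G$ is nilpotent. A complete set of Sylow subgroups of $G$ contains exactly one Sylow $p$-subgroup for each prime $p$ dividing $|G|$ (as in the more general notion of complete Hall set used here, it may in addition contain the trivial subgroup). $F(G)$ is the Fitting subgroup and $Z_\infty(G)$ the hypercentre of $G$. A maximal nilpotent subgroup is one maximal under inclusion among nilpotent subgroups of $G$. A Carter subgroup of $G$ is a nilpotent subgroup $H$ with $N_G(H)=H$. In (ii), $F_{0\sigma}(G)$ is simply notation for the product $P_1\cdots P_r$. *)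

theory Defs
  imports "HOL-Algebra.Algebra"
begin

primrec upper_central_series :: "('a, 'b) monoid_scheme \<Rightarrow> nat \<Rightarrow> 'a set" where
  "upper_central_series G 0 = {\<one>\<^bsub>G\<^esub>}"
| "upper_central_series G (Suc n) =
     {x \<in> carrier G. \<forall>y \<in> carrier G.
        x \<otimes>\<^bsub>G\<^esub> y \<otimes>\<^bsub>G\<^esub> inv\<^bsub>G\<^esub> x \<otimes>\<^bsub>G\<^esub> inv\<^bsub>G\<^esub> y \<in> upper_central_series G n}"

text \<open>
  The union below is the last term of the (finite) upper central series when \<open>G\<close> is finite.
\<close>

definition hypercentre :: "('a, 'b) monoid_scheme \<Rightarrow> 'a set" where
  "hypercentre G = (\<Union>n. upper_central_series G n)"

definition nilpotent_group :: "('a, 'b) monoid_scheme \<Rightarrow> bool" where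
  "nilpotent_group G \<longleftrightarrow> group G \<and> (\<exists>n. upper_central_series G n = carrier G)"

definition nilpotent_subgroup :: "'a set \<Rightarrow> ('a, 'b) monoid_scheme \<Rightarrow> bool" where
  "nilpotent_subgroup A G \<longleftrightarrow> subgroup A G \<and> nilpotent_group (G\<lparr>carrier := A\<rparr>)"

definition maximal_nilpotent_subgroup :: "'a set \<Rightarrow> ('a, 'b) monoid_scheme \<Rightarrow> bool" where
  "maximal_nilpotent_subgroup A G \<longleftrightarrow>
     nilpotent_subgroup A G \<and> (\<forall>B. nilpotent_subgroup B G \<longrightarrow> A \<subseteq> B \<longrightarrow> B = A)"

inductive subnormal_subgroup :: "'a set \<Rightarrow> ('a, 'b) monoid_scheme \<Rightarrow> bool" where
  whole: "subnormal_subgroup (carrier G) G"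
| step: "subnormal_subgroup K G \<Longrightarrow> H \<lhd> G\<lparr>carrier := K\<rparr> \<Longrightarrow> subnormal_subgroup H G"

definition weakly_semi_nilpotent :: "('a, 'b) monoid_scheme \<Rightarrow> bool" where
  "weakly_semi_nilpotent G \<longleftrightarrow>
     (\<forall>A. nilpotent_subgroup A G \<longrightarrow> \<not> subnormal_subgroup A G \<longrightarrow>
        nilpotent_subgroup (normalizer G A) G)"

definition fitting_subgroup :: "('a, 'b) monoid_scheme \<Rightarrow> 'a set" where
  "fitting_subgroup G = generate G (\<Union>{N. N \<lhd> G \<and> nilpotent_subgroup N G})"

definition carter_subgroup :: "'a set \<Rightarrow> ('a, 'b) monoid_scheme \<Rightarrow> bool" where
  "carter_subgroup H G \<longleftrightarrow> nilpotent_subgroup H G \<and> normalizer G H = H"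

definition sylow_subgroup :: "nat \<Rightarrow> 'a set \<Rightarrow> ('a, 'b) monoid_scheme \<Rightarrow> bool" where
  "sylow_subgroup p P G \<longleftrightarrow> subgroup P G \<and> card P = p ^ multiplicity p (order G)"

text \<open>
  As for complete Hall sets, the trivial subgroup is allowed as an additional member.
\<close>

definition complete_sylow_set :: "'a set set \<Rightarrow> ('a, 'b) monoid_scheme \<Rightarrow> bool" where
  "complete_sylow_set S G \<longleftrightarrow>
     (\<forall>P \<in> S. P = {\<one>\<^bsub>G\<^esub>} \<or> (\<exists>p. Factorial_Ring.prime p \<and> p dvd order G \<and> sylow_subgroup p P G)) \<and>
     (\<forall>p. Factorial_Ring.prime p \<longrightarrow> p dvd order G \<longrightarrow> (\<exists>!P. P \<in> S \<and> sylow_subgroup p P G))"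

text \<open>
  \<open>H\<close> is the internal direct product of the subgroups \<open>P i\<close>, \<open>i \<in> I\<close>; the empty direct product
  is the trivial subgroup.
\<close>

definition internal_direct_product ::
    "'a set \<Rightarrow> 'i set \<Rightarrow> ('i \<Rightarrow> 'a set) \<Rightarrow> ('a, 'b) monoid_scheme \<Rightarrow> bool" where
  "internal_direct_product H I P G \<longleftrightarrow>
     H = generate G (\<Union>i\<in>I. P i) \<and>
     (\<forall>i\<in>I. P i \<lhd> G\<lparr>carrier := H\<rparr>) \<and>
     (\<forall>i\<in>I. P i \<inter> generate G (\<Union>j\<in>I - {i}. P j) = {\<one>\<^bsub>G\<^esub>})"

text \<open>The product \<open>P 1 \<cdot> \<dots> \<cdot> P r\<close> of subsets.\<close>

primrec prod_upto :: "('a, 'b) monoid_scheme \<Rightarrow> (nat \<Rightarrow> 'a set) \<Rightarrow> nat \<Rightarrow> 'a set" where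
  "prod_upto G P 0 = {\<one>\<^bsub>G\<^esub>}"
| "prod_upto G P (Suc r) = prod_upto G P r <#>\<^bsub>G\<^esub> P (Suc r)"

end

theory Submission
  imports Defs
begin

text \<open>
  Write \<open>F\<close> for the Fitting subgroup. A nilpotent subnormal subgroup lies in \<open>F\<close>, so every nilpotent
  subgroup not contained in \<open>F\<close> has a nilpotent normalizer. Hence a maximal nilpotent subgroup \<open>H\<close> not
  contained in \<open>F\<close> is self-normalizing, and, since normalizers grow in nilpotent groups, two distinct
  such subgroups meet inside \<open>F\<close>. The conjugates of \<open>H - F\<close> are therefore disjoint and cover at least
  half of \<open>G\<close>, while missing the identity. So all such \<open>H\<close> are conjugate, and counting \<open>G - F\<close> exactly
  gives \<open>G = F H\<close>.

  A non-normal Sylow subgroup is nilpotent and not contained in \<open>F\<close>, so up to conjugacy all of them lie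
  in one \<open>H\<close>, where they generate their direct product. If \<open>p\<close> belongs to such a Sylow subgroup, then
  \<open>O\<^sub>p(G) \<subseteq> H\<close> and \<open>G = F H\<close> is the product of the centralizer of \<open>O\<^sub>p(G)\<close> and \<open>H\<close>; thus \<open>G\<close> acts on
  \<open>O\<^sub>p(G)\<close> as the nilpotent group \<open>H\<close> does, which puts \<open>O\<^sub>p(G)\<close> into the hypercentre.
\<close>

subsection \<open>Conjugates of subsets\<close>

text \<open>The factor one half comes from Lagrange: \<open>H - F\<close> is \<open>H\<close>
  without a proper subgroup. Two facts about \<open>G - F\<close> carry the count. It lacks the
  identity, so it cannot hold two disjoint sets of at least |G|/2 elements each. And each of its
  elements generates a cyclic, hence nilpotent, subgroup not contained in \<open>F\<close>, so the
  conjugates of \<open>H - F\<close> fill it completely. Comparing sizes then gives |G| |H \<inter>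
  F| = |H| |F|, which is the product formula for \<open>F H\<close>.

  Nilpotency is handled by commutators alone, and no quotient group is formed. One transfer lemma
  for upper central series, in which factors centralizing a normal subgroup may be discarded, yields
  that subgroups inherit nilpotency, that the hypercentre and \<open>F\<close> are nilpotent, and
  that O_p(G) is hypercentral. The last two rest on \<open>F\<close> being generated by the
  subgroups O_q(G): those with q \<noteq> p centralize O_p(G), which is why \<open>G\<close> is the
  centralizer times \<open>H\<close>.

  If \<open>G\<close> is nilpotent, no \<open>H\<close> outside \<open>F\<close> exists; then
  \<open>F\<close> itself serves as the nilpotent supplement.\<close>

definition conjugate :: "('a, 'b) monoid_scheme \<Rightarrow> 'a \<Rightarrow> 'a set \<Rightarrow> 'a set" where
  "conjugate G g A = (\<lambda>x. g \<otimes>\<^bsub>G\<^esub> x \<otimes>\<^bsub>G\<^esub> inv\<^bsub>G\<^esub> g) ` A"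

context group
begin

lemma inv_mult_cancel:
  "x \<in> carrier G \<Longrightarrow> y \<in> carrier G \<Longrightarrow> inv x \<otimes> (x \<otimes> y) = y"
  "x \<in> carrier G \<Longrightarrow> y \<in> carrier G \<Longrightarrow> x \<otimes> (inv x \<otimes> y) = y"
  by (simp_all flip: m_assoc)

text \<open>Brackets move right, inverses move inwards, and adjacent inverse pairs cancel: with the
  default simp rules this brings words to reduced form, which settles the commutator identities
  below.\<close>

lemmas group_norm = m_assoc inv_mult_group inv_mult_cancel

lemma conjugate_mono: "A \<subseteq> B \<Longrightarrow> conjugate G g A \<subseteq> conjugate G g B"
  unfolding conjugate_def by blast

lemma conjugate_subset_carrier:
  "g \<in> carrier G \<Longrightarrow> A \<subseteq> carrier G \<Longrightarrow> conjugate G g A \<subseteq> carrier G"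
  unfolding conjugate_def by auto

lemma conjugate_mult:
  assumes "g \<in> carrier G" "h \<in> carrier G" "A \<subseteq> carrier G"
  shows "conjugate G g (conjugate G h A) = conjugate G (g \<otimes> h) A"
  using assms unfolding conjugate_def image_image
  by (intro image_cong refl) (auto simp: group_norm subset_iff)

lemma conjugate_one: "A \<subseteq> carrier G \<Longrightarrow> conjugate G \<one> A = A"
  unfolding conjugate_def by (auto simp: subset_iff image_iff)

lemma conjugate_inv_conjugate:
  assumes "g \<in> carrier G" "A \<subseteq> carrier G"
  shows "conjugate G (inv g) (conjugate G g A) = A"
    and "conjugate G g (conjugate G (inv g) A) = A"
  using assms by (simp_all add: conjugate_mult conjugate_one)

lemma conjugate_subset_iff:
  assumes "g \<in> carrier G" "A \<subseteq> carrier G" "B \<subseteq> carrier G"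
  shows "conjugate G g A \<subseteq> B \<longleftrightarrow> A \<subseteq> conjugate G (inv g) B"
  using assms by (metis conjugate_mono conjugate_inv_conjugate)

lemma inj_on_conjugation:
  assumes "g \<in> carrier G" "A \<subseteq> carrier G"
  shows "inj_on (\<lambda>x. g \<otimes> x \<otimes> inv g) A"
  using assms by (auto simp: inj_on_def subset_iff)

lemma card_conjugate:
  "g \<in> carrier G \<Longrightarrow> A \<subseteq> carrier G \<Longrightarrow> card (conjugate G g A) = card A"
  unfolding conjugate_def by (simp add: card_image inj_on_conjugation)

lemma conjugate_subgroup:
  assumes g: "g \<in> carrier G" and A: "subgroup A G"
  shows "subgroup (conjugate G g A) G"
proof (rule subgroupI)
  show "conjugate G g A \<subseteq> carrier G"
    using conjugate_subset_carrier g A subgroup.subset by blast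
  show "conjugate G g A \<noteq> {}"
    using A subgroup_nonempty unfolding conjugate_def by (metis image_is_empty)
next
  fix a assume "a \<in> conjugate G g A"
  then obtain x where x: "x \<in> A" "a = g \<otimes> x \<otimes> inv g"
    unfolding conjugate_def by blast
  then have "inv a = g \<otimes> inv x \<otimes> inv g"
    using g A subgroup.mem_carrier[OF A] by (simp add: group_norm)
  then show "inv a \<in> conjugate G g A"
    using x subgroup.m_inv_closed[OF A] unfolding conjugate_def by blast
next
  fix a b assume "a \<in> conjugate G g A" "b \<in> conjugate G g A"
  then obtain x y where x: "x \<in> A" "a = g \<otimes> x \<otimes> inv g" and y: "y \<in> A" "b = g \<otimes> y \<otimes> inv g"
    unfolding conjugate_def by blast
  then have "a \<otimes> b = g \<otimes> (x \<otimes> y) \<otimes> inv g"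
    using g A subgroup.mem_carrier[OF A] by (simp add: group_norm)
  then show "a \<otimes> b \<in> conjugate G g A"
    using x y subgroup.m_closed[OF A] unfolding conjugate_def by blast
qed

text \<open>Conjugation by \<open>inv g\<close> also maps \<open>A\<close> into itself; moving it to
  the other side gives the reverse inclusion.\<close>

lemma conjugate_self:
  assumes "subgroup A G" "g \<in> A"
  shows "conjugate G g A = A"
proof -
  have sub: "conjugate G h A \<subseteq> A" if "h \<in> A" for h
    using assms(1) that unfolding conjugate_def
    by (auto intro!: subgroup.m_closed subgroup.m_inv_closed)
  have "A \<subseteq> conjugate G (inv (inv g)) A"
    using conjugate_subset_iff[of "inv g" A A] sub[of "inv g"] assms
    by (simp add: subgroup.mem_carrier subgroup.subset subgroup.m_inv_closed)
  then show ?thesis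
    using sub[of g] assms by (simp add: subgroup.mem_carrier)
qed

lemma conjugate_normal:
  assumes "N \<lhd> G" "g \<in> carrier G"
  shows "conjugate G g N = N"
proof -
  have sub: "conjugate G h N \<subseteq> N" if "h \<in> carrier G" for h
    using normal_invE[OF assms(1)] that unfolding conjugate_def by auto
  have "N \<subseteq> conjugate G (inv (inv g)) N"
    using conjugate_subset_iff[of "inv g" N N] sub[of "inv g"] assms
    by (simp add: normal_imp_subgroup subgroup.subset)
  then show ?thesis
    using sub[of g] assms by simp
qed

lemma normal_iff_conjugate:
  "N \<lhd> G \<longleftrightarrow> subgroup N G \<and> (\<forall>g\<in>carrier G. conjugate G g N \<subseteq> N)"
  unfolding normal_inv_iff conjugate_def by auto

lemma normalizer_eq:
  assumes "A \<subseteq> carrier G"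
  shows "normalizer G A = {g \<in> carrier G. conjugate G g A = A}"
proof -
  have "g <# A #> inv g = conjugate G g A" for g
    unfolding conjugate_def l_coset_def r_coset_def by auto
  then show ?thesis
    using assms unfolding normalizer_def stabilizer_def by simp
qed

lemma subgroup_restrict_iff:
  assumes "subgroup H G"
  shows "subgroup A (G\<lparr>carrier := H\<rparr>) \<longleftrightarrow> subgroup A G \<and> A \<subseteq> H"
proof
  assume A: "subgroup A (G\<lparr>carrier := H\<rparr>)"
  from subgroup.subset[OF this] incl_subgroup[OF assms this]
  show "subgroup A G \<and> A \<subseteq> H" by simp
qed (simp add: subgroup_incl assms)

lemma conjugate_restrict:
  assumes "subgroup H G" "g \<in> H"
  shows "conjugate (G\<lparr>carrier := H\<rparr>) g A = conjugate G g A"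
  using assms unfolding conjugate_def by simp

text \<open>Translates normality inside \<open>H\<close> into conjugation in \<open>G\<close>, so
  that later arguments can compare conjugates without changing the ambient group.\<close>

lemma normal_restrict_iff:
  assumes "subgroup H G"
  shows "N \<lhd> G\<lparr>carrier := H\<rparr> \<longleftrightarrow> subgroup N G \<and> N \<subseteq> H \<and> (\<forall>g\<in>H. conjugate G g N \<subseteq> N)"
proof -
  interpret H: group "G\<lparr>carrier := H\<rparr>"
    using assms by (rule subgroup_imp_group)
  show ?thesis
    unfolding H.normal_iff_conjugate subgroup_restrict_iff[OF assms]
    using assms by (simp add: conjugate_restrict)
qed

lemma card_subgroup_dvd:
  assumes "subgroup A G" "subgroup B G" "A \<subseteq> B"
  shows "card A dvd card B"
proof -
  have "subgroup A (G\<lparr>carrier := B\<rparr>)"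
    using assms by (simp add: subgroup_restrict_iff)
  from group.lagrange[OF subgroup_imp_group[OF assms(2)] this] show ?thesis
    unfolding order_def by (simp add: dvd_def) (metis mult.commute)
qed

lemma subgroup_Int: "subgroup A G \<Longrightarrow> subgroup B G \<Longrightarrow> subgroup (A \<inter> B) G"
  by (rule subgroups_Inter_pair)

lemma Int_eq_one_of_coprime:
  assumes "subgroup A G" "subgroup B G" "coprime (card A) (card B)"
  shows "A \<inter> B = {\<one>}"
proof -
  have "card (A \<inter> B) dvd card A" "card (A \<inter> B) dvd card B"
    using assms(1,2) by (simp_all add: card_subgroup_dvd subgroup_Int)
  then have "card (A \<inter> B) dvd 1"
    using assms(3) coprime_common_divisor by blast
  then obtain x where "A \<inter> B = {x}"
    by (metis card_1_singletonE nat_dvd_1_iff_1)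
  moreover have "\<one> \<in> A \<inter> B"
    using assms(1,2) by (simp add: subgroup.one_closed)
  ultimately show ?thesis
    by simp
qed

text \<open>Bracketed one way, the commutator is \<open>a\<close> times a conjugate of
  \<open>inv a\<close>; bracketed the other way, it is a conjugate of \<open>b\<close> times
  \<open>inv b\<close>. So it lies in both subgroups.\<close>

lemma normals_commute:
  assumes "A \<lhd> G" "B \<lhd> G" "A \<inter> B = {\<one>}" "a \<in> A" "b \<in> B"
  shows "a \<otimes> b = b \<otimes> a"
proof -
  have c: "a \<in> carrier G" "b \<in> carrier G"
    using assms by (meson normal_imp_subgroup subgroup.mem_carrier)+
  have "a \<otimes> (b \<otimes> inv a \<otimes> inv b) \<in> A" "(a \<otimes> b \<otimes> inv a) \<otimes> inv b \<in> B"
    using assms c by (meson normal_invE normal_imp_subgroup subgroup.m_closed subgroup.m_inv_closed)+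
  moreover have "a \<otimes> (b \<otimes> inv a \<otimes> inv b) = (a \<otimes> b) \<otimes> inv (b \<otimes> a)"
    "(a \<otimes> b \<otimes> inv a) \<otimes> inv b = (a \<otimes> b) \<otimes> inv (b \<otimes> a)"
    using c by (simp_all add: group_norm)
  ultimately have "(a \<otimes> b) \<otimes> inv (b \<otimes> a) = \<one>"
    using assms(3) by auto
  then show ?thesis
    using c by (metis inv_closed inv_equality inv_inv m_closed)
qed

end

subsection \<open>Counting by fibres\<close>

lemma card_eq_fibre_card_times:
  assumes "finite A" and "\<And>y. y \<in> f ` A \<Longrightarrow> card {x \<in> A. f x = y} = n"
  shows "card A = n * card (f ` A)"
proof -
  have "card A = (\<Sum>x\<in>A. 1)" by simp
  also have "\<dots> = (\<Sum>y\<in>f ` A. \<Sum>x\<in>{x \<in> A. f x = y}. 1)"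
    using assms(1) by (rule sum.image_gen)
  also have "\<dots> = (\<Sum>y\<in>f ` A. n)"
    using assms(2) by (intro sum.cong) auto
  finally show ?thesis by simp
qed

context group
begin

text \<open>The fibre of multiplication over \<open>a \<otimes> b\<close> consists of the pairs
  \<open>(a \<otimes> d, inv d \<otimes> b)\<close> with \<open>d\<close> in the
  intersection.\<close>

lemma card_set_mult:
  assumes A: "subgroup A G" and B: "subgroup B G" and fin: "finite (carrier G)"
  shows "card A * card B = card (A \<inter> B) * card (A <#> B)"
proof -
  have sub: "A \<subseteq> carrier G" "B \<subseteq> carrier G"
    using A B subgroup.subset by auto
  have finAB: "finite A" "finite B"
    using sub fin finite_subset by auto
  let ?f = "\<lambda>(a, b). a \<otimes> b"
  have "card {z \<in> A \<times> B. ?f z = y} = card (A \<inter> B)" if y: "y \<in> ?f ` (A \<times> B)" for y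
  proof -
    obtain a b where ab: "a \<in> A" "b \<in> B" "y = a \<otimes> b"
      using y by auto
    let ?g = "\<lambda>d. (a \<otimes> d, inv d \<otimes> b)"
    have "{z \<in> A \<times> B. ?f z = y} = ?g ` (A \<inter> B)"
    proof (intro subset_antisym subsetI)
      fix z assume "z \<in> {z \<in> A \<times> B. ?f z = y}"
      then obtain a' b' where z: "z = (a', b')" "a' \<in> A" "b' \<in> B" "a' \<otimes> b' = a \<otimes> b"
        using ab by auto
      have c: "a \<in> carrier G" "b \<in> carrier G" "a' \<in> carrier G" "b' \<in> carrier G"
        using sub z ab by auto
      have "inv a \<otimes> (a' \<otimes> b') \<otimes> inv b' = inv a \<otimes> (a \<otimes> b) \<otimes> inv b'"
        by (simp only: z(4))
      then have d: "inv a \<otimes> a' = b \<otimes> inv b'"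
        using c by (simp add: group_norm)
      have "inv a \<otimes> a' \<in> A" "b \<otimes> inv b' \<in> B"
        using A B ab z by (simp_all add: subgroup.m_closed subgroup.m_inv_closed)
      with d have "inv a \<otimes> a' \<in> A \<inter> B" by simp
      moreover have "z = ?g (inv a \<otimes> a')"
      proof -
        have "a \<otimes> (inv a \<otimes> a') = a'" "inv (b \<otimes> inv b') \<otimes> b = b'"
          using c by (simp_all add: group_norm)
        then show ?thesis
          unfolding z(1) prod.inject by (metis d)
      qed
      ultimately show "z \<in> ?g ` (A \<inter> B)"
        by (rule rev_image_eqI)
    next
      fix z assume "z \<in> ?g ` (A \<inter> B)"
      then obtain d where d: "d \<in> A" "d \<in> B" "z = (a \<otimes> d, inv d \<otimes> b)"
        by auto
      have c: "a \<in> carrier G" "b \<in> carrier G" "d \<in> carrier G"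
        using sub d ab by auto
      show "z \<in> {z \<in> A \<times> B. ?f z = y}"
        using d ab A B c by (simp add: subgroup.m_closed subgroup.m_inv_closed group_norm)
    qed
    moreover have "inj_on ?g (A \<inter> B)"
    proof (rule inj_onI)
      fix d e assume "d \<in> A \<inter> B" "e \<in> A \<inter> B" "?g d = ?g e"
      then have "a \<otimes> d = a \<otimes> e" "a \<in> carrier G" "d \<in> carrier G" "e \<in> carrier G"
        using sub ab by auto
      then show "d = e"
        by simp
    qed
    ultimately show ?thesis
      by (simp add: card_image)
  qed
  then have "card (A \<times> B) = card (A \<inter> B) * card (?f ` (A \<times> B))"
    using finAB by (intro card_eq_fibre_card_times) simp_all
  moreover have "?f ` (A \<times> B) = A <#> B"
    unfolding set_mult_def by auto
  ultimately show ?thesis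
    by (simp add: card_cartesian_product)
qed

end

subsection \<open>Fixed points of p-groups and Sylow's second theorem\<close>

text \<open>Orbit sizes divide \<open>p ^ k\<close>, so every orbit with more than one point has
  size divisible by \<open>p\<close>. Both directions are used: indivisibility produces a fixed
  point in Sylow's theorem, and divisibility produces a second fixed point in the centre argument
  for p-groups.\<close>

lemma card_fixed_points_cong:
  fixes G (structure) and act :: "'a \<Rightarrow> 'c \<Rightarrow> 'c" and E :: "'c set"
  assumes G: "group G" and p: "Factorial_Ring.prime (p :: nat)" and ord: "order G = p ^ k"
    and E: "finite E" and closed: "\<And>g x. g \<in> carrier G \<Longrightarrow> x \<in> E \<Longrightarrow> act g x \<in> E"
    and one: "\<And>x. x \<in> E \<Longrightarrow> act \<one>\<^bsub>G\<^esub> x = x"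
    and mult: "\<And>g h x. g \<in> carrier G \<Longrightarrow> h \<in> carrier G \<Longrightarrow> x \<in> E \<Longrightarrow>
                 act (g \<otimes>\<^bsub>G\<^esub> h) x = act g (act h x)"
  shows "p dvd card E \<longleftrightarrow> p dvd card {x \<in> E. \<forall>g\<in>carrier G. act g x = x}"
proof -
  interpret group G by fact
  \<comment> \<open>Elements of \<open>BijGroup E\<close> are extensional on \<open>E\<close>, hence
    the restriction.\<close>
  define \<phi> where "\<phi> g = restrict (act g) E" for g
  have inv_act: "act (inv g) (act g x) = x" "act g (act (inv g) x) = x"
    if "g \<in> carrier G" "x \<in> E" for g x
    using that by (simp_all flip: mult add: one)
  have bij: "\<phi> g \<in> Bij E" if "g \<in> carrier G" for g
    unfolding \<phi>_def Bij_def using that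
    by (auto intro!: bij_betw_byWitness[where f' = "act (inv g)"] simp: inv_act closed)
  have act: "group_action G E \<phi>"
    unfolding group_action_def
  proof (rule group_hom.intro[OF G group_BijGroup], unfold group_hom_axioms_def, rule homI)
    show "\<phi> g \<in> carrier (BijGroup E)" if "g \<in> carrier G" for g
      using bij[OF that] by (simp add: BijGroup_def)
    show "\<phi> (g \<otimes> h) = \<phi> g \<otimes>\<^bsub>BijGroup E\<^esub> \<phi> h" if "g \<in> carrier G" "h \<in> carrier G" for g h
      using that bij by (auto simp: BijGroup_def \<phi>_def compose_def mult closed fun_eq_iff)
  qed
  interpret group_action G E \<phi> by fact
  have orb: "orbit G \<phi> x = (\<lambda>g. act g x) ` carrier G" if "x \<in> E" for x
    using that unfolding orbit_def \<phi>_def by auto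
  let ?F = "{x \<in> E. \<forall>g\<in>carrier G. act g x = x}"
  let ?O = "orbits G E \<phi>"
  have cover: "\<Union>?O = E" by (rule orbits_coverture)
  have finO: "finite ?O"
    using cover E by (simp add: finite_UnionD)
  have disj: "pairwise disjnt ?O"
    using disjoint_union unfolding pairwise_def disjnt_def by blast
  have fixed: "?O \<inter> {B. card B = 1} = (\<lambda>x. {x}) ` ?F"
  proof (intro subset_antisym subsetI)
    fix B assume B: "B \<in> ?O \<inter> {B. card B = 1}"
    then obtain x where x: "x \<in> E" "B = orbit G \<phi> x"
      unfolding orbits_def by blast
    then have "x \<in> B" using orbit_refl by blast
    with B have "B = {x}" by (auto simp: card_1_singleton_iff)
    then have "\<forall>g\<in>carrier G. act g x = x"
      using orb x by auto
    with x \<open>B = {x}\<close> show "B \<in> (\<lambda>x. {x}) ` ?F" by blast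
  next
    fix B assume "B \<in> (\<lambda>x. {x}) ` ?F"
    then obtain x where x: "x \<in> E" "\<forall>g\<in>carrier G. act g x = x" "B = {x}" by blast
    then have "orbit G \<phi> x = {x}"
      using orb[of x] by auto
    then show "B \<in> ?O \<inter> {B. card B = 1}"
      using x unfolding orbits_def by auto
  qed
  have dvd: "p dvd card B" if "B \<in> ?O" "card B \<noteq> 1" for B
  proof -
    obtain x where x: "x \<in> E" "B = orbit G \<phi> x"
      using \<open>B \<in> ?O\<close> unfolding orbits_def by blast
    have "card B dvd p ^ k"
      using orbit_stabilizer_theorem[OF x(1)] x(2) ord by (metis dvd_triv_left)
    then obtain i where "card B = p ^ i"
      using p divides_primepow_nat by blast
    with that show ?thesis by (cases i) auto
  qed
  have "card E = (\<Sum>B\<in>?O. card B)"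
    using card_Union_disjoint[OF disj] cover E by (metis Union_upper finite_subset)
  also have "\<dots> = (\<Sum>B\<in>?O \<inter> {B. card B = 1}. card B) + (\<Sum>B\<in>?O - {B. card B = 1}. card B)"
    using finO by (rule sum.Int_Diff)
  also have "(\<Sum>B\<in>?O \<inter> {B. card B = 1}. card B) = card ?F"
    unfolding fixed by (subst sum.reindex) (auto simp: inj_on_def)
  finally have "card E = card ?F + (\<Sum>B\<in>?O - {B. card B = 1}. card B)" .
  moreover have "p dvd (\<Sum>B\<in>?O - {B. card B = 1}. card B)"
    using dvd by (intro dvd_sum) auto
  ultimately show ?thesis
    by (simp add: dvd_add_left_iff)
qed

context group
begin

lemma exists_sylow_subgroup:
  assumes "finite (carrier G)" "Factorial_Ring.prime p"
  shows "\<exists>P. sylow_subgroup p P G"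
proof -
  have "order G \<noteq> 0"
    using assms(1) order_gt_0_iff_finite by simp
  then obtain m where "order G = p ^ multiplicity p (order G) * m"
    using multiplicity_dvd[of p "order G"] by (auto simp: dvd_def)
  then show ?thesis
    using sylow_thm[OF assms(2) is_group _ assms(1)] unfolding sylow_subgroup_def by blast
qed

text \<open>\<open>Q\<close> acts on the right cosets of \<open>P\<close>, whose number is prime to
  \<open>p\<close>, so some coset \<open>P #> x\<close> is fixed; being fixed by \<open>g\<close>
  means \<open>x \<otimes> g \<otimes> inv x \<in> P\<close>.\<close>

lemma p_subgroup_conjugate_into_sylow:
  assumes fin: "finite (carrier G)" and p: "Factorial_Ring.prime p"
    and P: "sylow_subgroup p P G" and Q: "subgroup Q G" "card Q = p ^ k"
  obtains x where "x \<in> carrier G" "conjugate G x Q \<subseteq> P"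
proof -
  have PG: "subgroup P G" and cP: "card P = p ^ multiplicity p (order G)"
    using P unfolding sylow_subgroup_def by auto
  interpret Q: group "G\<lparr>carrier := Q\<rparr>"
    using Q(1) by (rule subgroup_imp_group)
  have Qc: "Q \<subseteq> carrier G" and Pc: "P \<subseteq> carrier G"
    using Q PG subgroup.subset by auto
  have finX: "finite (rcosets P)"
    using fin rcosets_part_G[OF PG] by (simp add: finite_UnionD)
  \<comment> \<open>The inverse turns right multiplication into a left action.\<close>
  let ?act = "\<lambda>g C. C #> inv g"
  let ?F = "{C \<in> rcosets P. \<forall>g\<in>carrier (G\<lparr>carrier := Q\<rparr>). ?act g C = C}"
  have "p dvd card (rcosets P) \<longleftrightarrow> p dvd card ?F"
  proof (rule card_fixed_points_cong[where k = k and act = ?act])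
    show "order (G\<lparr>carrier := Q\<rparr>) = p ^ k"
      using Q by (simp add: order_def)
    show "?act g C \<in> rcosets P" if "g \<in> carrier (G\<lparr>carrier := Q\<rparr>)" "C \<in> rcosets P" for g C
      using that Qc Pc unfolding RCOSETS_def by (auto simp: coset_mult_assoc subset_iff)
    show "?act \<one>\<^bsub>G\<lparr>carrier := Q\<rparr>\<^esub> C = C" if "C \<in> rcosets P" for C
      using that rcosets_subset_PowG[OF PG] by auto
    show "?act (g \<otimes>\<^bsub>G\<lparr>carrier := Q\<rparr>\<^esub> h) C = ?act g (?act h C)"
      if "g \<in> carrier (G\<lparr>carrier := Q\<rparr>)" "h \<in> carrier (G\<lparr>carrier := Q\<rparr>)" "C \<in> rcosets P" for g h C
      using that rcosets_subset_PowG[OF PG] Qc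
      by (subst coset_mult_assoc) (auto simp: inv_mult_group subset_iff)
  qed (use p finX in \<open>auto intro: Q.is_group\<close>)
  moreover have "\<not> p dvd card (rcosets P)"
  proof
    assume "p dvd card (rcosets P)"
    then have "p * p ^ multiplicity p (order G) dvd card (rcosets P) * card P"
      using cP by (simp add: mult_dvd_mono)
    then have "p ^ Suc (multiplicity p (order G)) dvd order G"
      using lagrange[OF PG] by simp
    moreover have "order G \<noteq> 0"
      using fin order_gt_0_iff_finite by simp
    ultimately show False
      using p by (metis Suc_n_not_le_n multiplicity_geI not_prime_unit)
  qed
  ultimately have "card ?F \<noteq> 0"
    by (metis dvd_0_right)
  then have "?F \<noteq> {}"
    by (metis card.empty)
  then obtain C where "C \<in> rcosets P" "\<forall>g\<in>Q. C #> inv g = C"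
    by auto
  then obtain x where x: "x \<in> carrier G" "\<forall>g\<in>Q. P #> x #> inv g = P #> x"
    unfolding RCOSETS_def by auto
  have "x \<otimes> g \<otimes> inv x \<in> P" if g: "g \<in> Q" for g
  proof -
    have gc: "g \<in> carrier G" using g Qc by auto
    have "P #> (x \<otimes> inv g) = P #> x #> inv g"
      using x(1) gc Pc by (simp add: coset_mult_assoc)
    also have "\<dots> = P #> x"
      using x(2) g by (rule bspec)
    finally have "P #> (x \<otimes> inv g) = P #> x" .
    then have "x \<otimes> inv g \<in> P #> x"
      using rcos_self[of "x \<otimes> inv g" P] x(1) gc PG by simp
    then obtain q where q: "q \<in> P" "x \<otimes> inv g = q \<otimes> x"
      unfolding r_coset_def by auto
    then have "q = x \<otimes> inv g \<otimes> inv x"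
      using x(1) gc Pc by (simp add: inv_solve_right subset_iff)
    then have "inv q = x \<otimes> g \<otimes> inv x"
      using x(1) gc by (simp add: group_norm)
    then show ?thesis
      using q(1) PG by (metis subgroup.m_inv_closed)
  qed
  then have "conjugate G x Q \<subseteq> P"
    unfolding conjugate_def by auto
  with x(1) show ?thesis by (rule that)
qed

end

subsection \<open>The upper central series\<close>

context group
begin

text \<open>This is the preimage of the centre of G/N. With [x, y] for the commutator, closure
  follows from [x z, y] = x [z, y] x^-1 [x, y], from [x^-1, y] = x^-1 [x, y]^-1 x, and, for
  normality, from [g x g^-1, y] = g [x, g^-1 y g] g^-1.\<close>

lemma commutators_in_normal:
  assumes N: "N \<lhd> G"
  shows "{x \<in> carrier G. \<forall>y\<in>carrier G. x \<otimes> y \<otimes> inv x \<otimes> inv y \<in> N} \<lhd> G" (is "?Z \<lhd> G")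
proof -
  have NG: "subgroup N G" and Nc: "\<And>x h. x \<in> carrier G \<Longrightarrow> h \<in> N \<Longrightarrow> x \<otimes> h \<otimes> inv x \<in> N"
    using normal_invE[OF N] by blast+
  have "subgroup ?Z G"
  proof (rule subgroupI)
    show "?Z \<noteq> {}"
      using subgroup.one_closed[OF NG] by (auto intro!: exI[of _ \<one>])
  next
    fix x assume x: "x \<in> ?Z"
    have "inv x \<otimes> y \<otimes> inv (inv x) \<otimes> inv y \<in> N" if y: "y \<in> carrier G" for y
    proof -
      have "inv x \<otimes> inv (x \<otimes> y \<otimes> inv x \<otimes> inv y) \<otimes> inv (inv x) \<in> N"
        by (rule Nc[OF _ subgroup.m_inv_closed[OF NG]]; use x y in simp)
      then show ?thesis
        using x y by (simp add: group_norm)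
    qed
    with x show "inv x \<in> ?Z" by simp
  next
    fix x z assume x: "x \<in> ?Z" and z: "z \<in> ?Z"
    have "x \<otimes> z \<otimes> y \<otimes> inv (x \<otimes> z) \<otimes> inv y \<in> N" if y: "y \<in> carrier G" for y
    proof -
      have "(x \<otimes> (z \<otimes> y \<otimes> inv z \<otimes> inv y) \<otimes> inv x) \<otimes> (x \<otimes> y \<otimes> inv x \<otimes> inv y) \<in> N"
        by (rule subgroup.m_closed[OF NG Nc]; use x y z in simp)
      then show ?thesis
        using x y z by (simp add: group_norm)
    qed
    with x z show "x \<otimes> z \<in> ?Z" by simp
  qed auto
  moreover have "g \<otimes> x \<otimes> inv g \<in> ?Z" if g: "g \<in> carrier G" and x: "x \<in> ?Z" for g x
  proof -
    have "g \<otimes> x \<otimes> inv g \<otimes> y \<otimes> inv (g \<otimes> x \<otimes> inv g) \<otimes> inv y \<in> N" if y: "y \<in> carrier G" for y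
    proof -
      let ?y = "inv g \<otimes> y \<otimes> g"
      have "g \<otimes> (x \<otimes> ?y \<otimes> inv x \<otimes> inv ?y) \<otimes> inv g \<in> N"
        by (rule Nc; use g x y in simp)
      then show ?thesis
        using g x y by (simp add: group_norm)
    qed
    with g x show ?thesis by simp
  qed
  ultimately show ?thesis
    unfolding normal_inv_iff by blast
qed

lemma upper_central_series_normal: "upper_central_series G n \<lhd> G"
  by (induction n) (simp_all add: one_is_normal commutators_in_normal)

lemma upper_central_series_subset_Suc:
  "upper_central_series G n \<subseteq> upper_central_series G (Suc n)"
proof
  fix x assume x: "x \<in> upper_central_series G n"
  note N = normal_invE[OF upper_central_series_normal[of n]]
  have xc: "x \<in> carrier G"
    using x N(1) by (rule subgroup.mem_carrier[rotated])
  have "x \<otimes> (y \<otimes> inv x \<otimes> inv y) \<in> upper_central_series G n" if "y \<in> carrier G" for y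
    by (rule subgroup.m_closed[OF N(1) x N(2)[OF that subgroup.m_inv_closed[OF N(1) x]]])
  then show "x \<in> upper_central_series G (Suc n)"
    using xc by (simp add: m_assoc)
qed

lemma upper_central_series_mono:
  "m \<le> n \<Longrightarrow> upper_central_series G m \<subseteq> upper_central_series G n"
  using upper_central_series_subset_Suc
  by (rule lift_Suc_mono_le[of "upper_central_series G"])

lemma upper_central_series_restrict_Suc:
  assumes "subgroup H G"
  shows "upper_central_series (G\<lparr>carrier := H\<rparr>) (Suc n) =
    {x \<in> H. \<forall>y\<in>H. x \<otimes> y \<otimes> inv x \<otimes> inv y \<in> upper_central_series (G\<lparr>carrier := H\<rparr>) n}"
  using assms
  by (auto simp del: upper_central_series.simps(2)
      simp add: upper_central_series.simps(2)[of "G\<lparr>carrier := H\<rparr>"])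

text \<open>
  If \<open>c\<close> centralizes \<open>K\<close> and \<open>x \<in> K\<close>, then \<open>[x, c h] = c [x, h] c\<^sup>-\<^sup>1 = [x, h]\<close> as \<open>[x, h] \<in> K\<close>.
\<close>

lemma upper_central_series_transfer:
  assumes K: "K \<lhd> G" and H: "subgroup H G" and L: "subgroup L G"
    and dec: "\<And>g. g \<in> L \<Longrightarrow>
      \<exists>c\<in>carrier G. \<exists>h\<in>H. g = c \<otimes> h \<and> (\<forall>k\<in>K. c \<otimes> k = k \<otimes> c)"
  shows "x \<in> K \<Longrightarrow> x \<in> L \<Longrightarrow> x \<in> upper_central_series (G\<lparr>carrier := H\<rparr>) n \<Longrightarrow>
    x \<in> upper_central_series (G\<lparr>carrier := L\<rparr>) n"
proof (induction n arbitrary: x)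
  case (Suc n)
  note Kn = normal_invE[OF K]
  have xH: "x \<in> H" and xn: "\<And>y. y \<in> H \<Longrightarrow>
      x \<otimes> y \<otimes> inv x \<otimes> inv y \<in> upper_central_series (G\<lparr>carrier := H\<rparr>) n"
    using Suc.prems(3) unfolding upper_central_series_restrict_Suc[OF H] by blast+
  have xc: "x \<in> carrier G"
    using H xH by (rule subgroup.mem_carrier)
  have "x \<otimes> y \<otimes> inv x \<otimes> inv y \<in> upper_central_series (G\<lparr>carrier := L\<rparr>) n" if y: "y \<in> L" for y
  proof -
    obtain c h where c: "c \<in> carrier G" and h: "h \<in> H" and y_eq: "y = c \<otimes> h"
      and ck: "\<And>k. k \<in> K \<Longrightarrow> c \<otimes> k = k \<otimes> c"
      using dec[OF y] by blast
    have hc: "h \<in> carrier G"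
      using H h by (rule subgroup.mem_carrier)
    have yc: "y \<in> carrier G"
      using L y by (rule subgroup.mem_carrier)
    define k where "k = x \<otimes> h \<otimes> inv x \<otimes> inv h"
    have "x \<otimes> (h \<otimes> inv x \<otimes> inv h) \<in> K"
      by (rule subgroup.m_closed[OF Kn(1) Suc.prems(1)
            Kn(2)[OF hc subgroup.m_inv_closed[OF Kn(1) Suc.prems(1)]]])
    then have kK: "k \<in> K"
      using xc hc by (simp add: k_def m_assoc)
    have kc: "k \<in> carrier G"
      using Kn(1) kK by (rule subgroup.mem_carrier)
    have "x \<otimes> y \<otimes> inv x \<otimes> inv y = (x \<otimes> c) \<otimes> (h \<otimes> inv x \<otimes> inv h \<otimes> inv c)"
      using xc c hc by (simp add: y_eq group_norm)
    also have "\<dots> = (c \<otimes> x) \<otimes> (h \<otimes> inv x \<otimes> inv h \<otimes> inv c)"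
      using ck[OF Suc.prems(1)] by simp
    also have "\<dots> = (c \<otimes> k) \<otimes> inv c"
      using xc c hc by (simp add: k_def m_assoc)
    also have "\<dots> = k"
      using ck[OF kK] c kc by (simp add: m_assoc)
    finally have eq: "x \<otimes> y \<otimes> inv x \<otimes> inv y = k" .
    have "k \<in> L"
      unfolding eq[symmetric] using Suc.prems(2) y
      by (intro subgroup.m_closed[OF L] subgroup.m_inv_closed[OF L])
    then show ?thesis
      using Suc.IH[OF kK] xn[OF h] unfolding eq k_def by blast
  qed
  then show ?case
    unfolding upper_central_series_restrict_Suc[OF L] using Suc.prems(2) by blast
qed simp

section \<open>Nilpotent subgroups\<close>

lemma upper_central_series_restrict_subset:
  assumes "subgroup H G"
  shows "upper_central_series (G\<lparr>carrier := H\<rparr>) n \<subseteq> H"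
proof (cases n)
  case 0
  then show ?thesis
    using subgroup.one_closed[OF assms] by simp
next
  case (Suc m)
  then show ?thesis
    using upper_central_series_restrict_Suc[OF assms, of m] by blast
qed

text \<open>The terms of the restricted series never leave \<open>H\<close>, so reaching
  \<open>H\<close> is a matter of one inclusion.\<close>

lemma nilpotent_subgroup_iff:
  "nilpotent_subgroup H G \<longleftrightarrow>
    subgroup H G \<and> (\<exists>n. H \<subseteq> upper_central_series (G\<lparr>carrier := H\<rparr>) n)"
proof (cases "subgroup H G")
  case True
  then have "upper_central_series (G\<lparr>carrier := H\<rparr>) n = H \<longleftrightarrow>
      H \<subseteq> upper_central_series (G\<lparr>carrier := H\<rparr>) n" for n
    using upper_central_series_restrict_subset by blast
  then show ?thesis
    unfolding nilpotent_subgroup_def nilpotent_group_def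
    using True subgroup_imp_group[OF True] by simp
qed (simp add: nilpotent_subgroup_def)

text \<open>The transfer lemma with the whole group as \<open>K\<close>: since \<open>L\<close> lies
  in \<open>H\<close>, the trivial decomposition \<open>g = \<one> \<otimes> g\<close> is
  admissible.\<close>

lemma nilpotent_subgroup_mono:
  assumes "nilpotent_subgroup H G" "subgroup L G" "L \<subseteq> H"
  shows "nilpotent_subgroup L G"
proof -
  obtain n where H: "subgroup H G" and n: "H \<subseteq> upper_central_series (G\<lparr>carrier := H\<rparr>) n"
    using assms(1) unfolding nilpotent_subgroup_iff by blast
  have "\<exists>c\<in>carrier G. \<exists>h\<in>H. g = c \<otimes> h \<and> (\<forall>k\<in>carrier G. c \<otimes> k = k \<otimes> c)"
    if "g \<in> L" for g
    by (rule bexI[of _ \<one>], rule bexI[of _ g])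
      (use that assms(3) subgroup.mem_carrier[OF assms(2)] in auto)
  note transfer = upper_central_series_transfer[OF normal_self H assms(2) this]
  have "L \<subseteq> upper_central_series (G\<lparr>carrier := L\<rparr>) n"
  proof
    fix x assume x: "x \<in> L"
    then show "x \<in> upper_central_series (G\<lparr>carrier := L\<rparr>) n"
      using assms(3) n subgroup.mem_carrier[OF assms(2)] by (intro transfer) blast+
  qed
  with assms(2) show ?thesis
    unfolding nilpotent_subgroup_iff by blast
qed

text \<open>Again transfer with trivial centralizing factor, now from \<open>G\<close> down to the
  term itself. It is what places the hypercentre inside the Fitting subgroup.\<close>

lemma nilpotent_upper_central_series: "nilpotent_subgroup (upper_central_series G n) G"
proof -
  let ?Z = "upper_central_series G n"
  have Z: "subgroup ?Z G"
    using normal_invE(1)[OF upper_central_series_normal] .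
  have "\<exists>c\<in>carrier G. \<exists>h\<in>carrier G. g = c \<otimes> h \<and> (\<forall>k\<in>carrier G. c \<otimes> k = k \<otimes> c)"
    if "g \<in> ?Z" for g
    by (rule bexI[of _ \<one>], rule bexI[of _ g]) (use that subgroup.mem_carrier[OF Z] in simp_all)
  note transfer = upper_central_series_transfer[OF normal_self subgroup_self Z this]
  have "?Z \<subseteq> upper_central_series (G\<lparr>carrier := ?Z\<rparr>) n"
  proof
    fix x assume x: "x \<in> ?Z"
    then show "x \<in> upper_central_series (G\<lparr>carrier := ?Z\<rparr>) n"
      using subgroup.mem_carrier[OF Z] by (intro transfer) simp_all
  qed
  with Z show ?thesis
    unfolding nilpotent_subgroup_iff by blast
qed

lemma conjugate_upper_central_series:
  assumes g: "g \<in> carrier G" and H: "subgroup H G"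
  shows "conjugate G g (upper_central_series (G\<lparr>carrier := H\<rparr>) n) \<subseteq>
    upper_central_series (G\<lparr>carrier := conjugate G g H\<rparr>) n"
proof (induction n)
  case 0
  then show ?case
    using g by (simp add: conjugate_def)
next
  case (Suc n)
  note gH = conjugate_subgroup[OF g H]
  show ?case
  proof
    fix z assume "z \<in> conjugate G g (upper_central_series (G\<lparr>carrier := H\<rparr>) (Suc n))"
    then obtain x where x: "x \<in> H" "z = g \<otimes> x \<otimes> inv g"
      and xn: "\<And>y. y \<in> H \<Longrightarrow>
        x \<otimes> y \<otimes> inv x \<otimes> inv y \<in> upper_central_series (G\<lparr>carrier := H\<rparr>) n"
      unfolding conjugate_def upper_central_series_restrict_Suc[OF H] by blast
    have xc: "x \<in> carrier G"
      using H x(1) by (rule subgroup.mem_carrier)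
    have "z \<otimes> w \<otimes> inv z \<otimes> inv w \<in> upper_central_series (G\<lparr>carrier := conjugate G g H\<rparr>) n"
      if "w \<in> conjugate G g H" for w
    proof -
      obtain y where y: "y \<in> H" "w = g \<otimes> y \<otimes> inv g"
        using \<open>w \<in> conjugate G g H\<close> unfolding conjugate_def by blast
      have yc: "y \<in> carrier G"
        using H y(1) by (rule subgroup.mem_carrier)
      have "z \<otimes> w \<otimes> inv z \<otimes> inv w = g \<otimes> (x \<otimes> y \<otimes> inv x \<otimes> inv y) \<otimes> inv g"
        using g xc yc by (simp add: x(2) y(2) group_norm)
      then show ?thesis
        using Suc.IH xn[OF y(1)] unfolding conjugate_def by blast
    qed
    moreover have "z \<in> conjugate G g H"
      using x unfolding conjugate_def by blast
    ultimately show "z \<in> upper_central_series (G\<lparr>carrier := conjugate G g H\<rparr>) (Suc n)"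
      unfolding upper_central_series_restrict_Suc[OF gH] by blast
  qed
qed

lemma conjugate_nilpotent_subgroup:
  assumes "g \<in> carrier G" "nilpotent_subgroup H G"
  shows "nilpotent_subgroup (conjugate G g H) G"
proof -
  obtain n where H: "subgroup H G" and n: "H \<subseteq> upper_central_series (G\<lparr>carrier := H\<rparr>) n"
    using assms(2) unfolding nilpotent_subgroup_iff by blast
  have "conjugate G g H \<subseteq> upper_central_series (G\<lparr>carrier := conjugate G g H\<rparr>) n"
    using conjugate_mono[OF n] conjugate_upper_central_series[OF assms(1) H] by blast
  with conjugate_subgroup[OF assms(1) H] show ?thesis
    unfolding nilpotent_subgroup_iff by blast
qed

lemma nilpotent_group_iff: "nilpotent_group G \<longleftrightarrow> nilpotent_subgroup (carrier G) G"
  unfolding nilpotent_subgroup_def using subgroup_self by simp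

text \<open>Take the first term of the upper central series of \<open>H\<close> not contained in
  \<open>A\<close> and an \<open>x\<close> in it outside \<open>A\<close>. Commutators of
  \<open>x\<close> with \<open>H\<close> fall into the previous term, hence into \<open>A\<close>,
  so \<open>x\<close> normalizes \<open>A\<close>.\<close>

lemma nilpotent_normalizer_grows:
  assumes H: "nilpotent_subgroup H G" and A: "subgroup A G" and AH: "A \<subset> H" and fin: "finite A"
  obtains x where "x \<in> H" "x \<notin> A" "conjugate G x A = A"
proof -
  obtain n where HG: "subgroup H G" and n: "H \<subseteq> upper_central_series (G\<lparr>carrier := H\<rparr>) n"
    using H unfolding nilpotent_subgroup_iff by blast
  let ?Z = "upper_central_series (G\<lparr>carrier := H\<rparr>)"
  define m where "m = (LEAST m. \<not> ?Z m \<subseteq> A)"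
  have "\<not> ?Z n \<subseteq> A"
    using n AH by blast
  then have m: "\<not> ?Z m \<subseteq> A" and least: "\<And>i. i < m \<Longrightarrow> ?Z i \<subseteq> A"
    unfolding m_def by (rule LeastI, auto dest: not_less_Least)
  have "m \<noteq> 0"
    using m subgroup.one_closed[OF A] by (intro notI) simp
  then obtain k where k: "m = Suc k"
    using not0_implies_Suc by blast
  obtain x where x: "x \<in> ?Z m" "x \<notin> A"
    using m by blast
  have xH: "x \<in> H" and xk: "\<And>y. y \<in> H \<Longrightarrow> x \<otimes> y \<otimes> inv x \<otimes> inv y \<in> A"
    using x(1) least[of k] unfolding k upper_central_series_restrict_Suc[OF HG] by blast+
  have xc: "x \<in> carrier G"
    using HG xH by (rule subgroup.mem_carrier)
  have sub: "conjugate G x A \<subseteq> A"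
  proof
    fix z assume "z \<in> conjugate G x A"
    then obtain a where a: "a \<in> A" "z = x \<otimes> a \<otimes> inv x"
      unfolding conjugate_def by blast
    have ac: "a \<in> carrier G"
      using A a(1) by (rule subgroup.mem_carrier)
    have "(x \<otimes> a \<otimes> inv x \<otimes> inv a) \<otimes> a \<in> A"
      by (rule subgroup.m_closed[OF A _ a(1)]) (use a(1) AH xk in blast)
    then show "z \<in> A"
      using a(2) xc ac by (simp add: m_assoc)
  qed
  moreover have "card (conjugate G x A) = card A"
    using xc subgroup.subset[OF A] by (rule card_conjugate)
  ultimately have "conjugate G x A = A"
    using fin by (intro card_subset_eq)
  with xH x(2) show ?thesis by (rule that)
qed

section \<open>Nilpotency of finite p-groups\<close>

lemma conjugate_rcoset:
  assumes N: "N \<lhd> G" and g: "g \<in> carrier G" and x: "x \<in> carrier G"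
  shows "conjugate G g (N #> x) = N #> (g \<otimes> x \<otimes> inv g)"
proof -
  have "conjugate G g (N #> x) = (\<lambda>n. n \<otimes> (g \<otimes> x \<otimes> inv g)) ` conjugate G g N"
    unfolding conjugate_def r_coset_def UNION_singleton_eq_range image_image
    using g x subgroup.mem_carrier[OF normal_imp_subgroup[OF N]]
    by (intro image_cong refl) (simp add: group_norm)
  also have "\<dots> = N #> (g \<otimes> x \<otimes> inv g)"
    unfolding conjugate_normal[OF N g] r_coset_def by blast
  finally show ?thesis .
qed

text \<open>In effect, the nontrivial p-group G/N has nontrivial centre. \<open>G\<close> acts by
  conjugation on the cosets of \<open>N\<close>, and the number of fixed cosets is divisible by
  \<open>p\<close>. As \<open>N\<close> is fixed, there is another fixed coset
  \<open>N #> x\<close>, and then \<open>x\<close> is central modulo \<open>N\<close>.\<close>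

lemma p_group_central_series_grows:
  assumes p: "Factorial_Ring.prime p" and ord: "order G = p ^ k"
    and N: "N \<lhd> G" and ne: "N \<noteq> carrier G"
  obtains x where "x \<in> carrier G" "x \<notin> N" "\<And>y. y \<in> carrier G \<Longrightarrow> x \<otimes> y \<otimes> inv x \<otimes> inv y \<in> N"
proof -
  have NG: "subgroup N G"
    using N by (rule normal_imp_subgroup)
  have fin: "finite (carrier G)"
    using ord p order_gt_0_iff_finite by (metis prime_gt_0_nat zero_less_power)
  have finR: "finite (rcosets N)"
    using fin rcosets_part_G[OF NG] by (simp add: finite_UnionD)
  have sub: "C \<subseteq> carrier G" if "C \<in> rcosets N" for C
    using that rcosets_subset_PowG[OF NG] by blast
  let ?F = "{C \<in> rcosets N. \<forall>g\<in>carrier G. conjugate G g C = C}"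
  have "p dvd card (rcosets N) \<longleftrightarrow> p dvd card ?F"
  proof (rule card_fixed_points_cong[OF is_group p ord finR])
    show "conjugate G g C \<in> rcosets N" if g: "g \<in> carrier G" and C: "C \<in> rcosets N" for g C
    proof -
      obtain x where "x \<in> carrier G" "C = N #> x"
        using C unfolding RCOSETS_def by blast
      then show ?thesis
        using g conjugate_rcoset[OF N g] unfolding RCOSETS_def by auto
    qed
  qed (use sub in \<open>simp_all add: conjugate_one conjugate_mult\<close>)
  moreover have "p dvd card (rcosets N)"
  proof -
    have eq: "card (rcosets N) * card N = p ^ k"
      using lagrange[OF NG] ord by simp
    then obtain i where i: "card (rcosets N) = p ^ i"
      using p divides_primepow_nat by (metis dvd_triv_left)
    have "i \<noteq> 0"
    proof
      assume "i = 0"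
      then have "card N = card (carrier G)"
        using i eq ord by (simp add: order_def)
      then show False
        using ne fin subgroup.subset[OF NG] card_subset_eq by blast
    qed
    with i show ?thesis by simp
  qed
  ultimately have dvd: "p dvd card ?F" by blast
  have NF: "N \<in> ?F"
    using subgroup.subgroup_in_rcosets[OF NG is_group] conjugate_normal[OF N] by simp
  have "?F \<noteq> {N}"
    using dvd p by (intro notI) (simp add: not_prime_unit)
  with NF obtain C where C: "C \<in> rcosets N" "\<forall>g\<in>carrier G. conjugate G g C = C" "C \<noteq> N"
    by blast
  obtain x where x: "x \<in> carrier G" "C = N #> x"
    using C(1) unfolding RCOSETS_def by blast
  have "x \<notin> N"
    using C(3) x coset_join2[OF x(1) NG] by blast
  moreover have "x \<otimes> y \<otimes> inv x \<otimes> inv y \<in> N" if y: "y \<in> carrier G" for y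
  proof -
    have "N #> (y \<otimes> x \<otimes> inv y) = N #> x"
      using C(2) y x conjugate_rcoset[OF N y x(1)] by simp
    then have "y \<otimes> x \<otimes> inv y \<in> N #> x"
      using rcos_self[OF _ NG, of "y \<otimes> x \<otimes> inv y"] x(1) y by simp
    then obtain n where n: "n \<in> N" "y \<otimes> x \<otimes> inv y = n \<otimes> x"
      unfolding r_coset_def by blast
    have nc: "n \<in> carrier G"
      using NG n(1) by (rule subgroup.mem_carrier)
    have "n = y \<otimes> x \<otimes> inv y \<otimes> inv x"
      using n(2) x(1) y nc by (simp add: inv_solve_right)
    then have "inv n = x \<otimes> y \<otimes> inv x \<otimes> inv y"
      using x(1) y by (simp add: group_norm)
    then show ?thesis
      using subgroup.m_inv_closed[OF NG n(1)] by simp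
  qed
  ultimately show ?thesis
    using that x(1) by blast
qed

text \<open>The series increases, so a term of greatest cardinality contains all others.\<close>

lemma hypercentre_eq_upper_central_series:
  assumes fin: "finite (carrier G)"
  obtains n where "hypercentre G = upper_central_series G n"
proof -
  let ?Z = "upper_central_series G"
  have sub: "?Z n \<subseteq> carrier G" for n
    using subgroup.subset[OF normal_imp_subgroup[OF upper_central_series_normal]] .
  have "card (?Z n) < Suc (card (carrier G))" for n
    using card_mono[OF fin sub[of n]] by simp
  then obtain n where n: "\<And>m. card (?Z m) \<le> card (?Z n)"
    using ex_has_greatest_nat[of "\<lambda>_. True" 0 "\<lambda>n. card (?Z n)"] by blast
  have "?Z m \<subseteq> ?Z n" for m
  proof -
    have "?Z n \<subseteq> ?Z (max m n)" "?Z m \<subseteq> ?Z (max m n)"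
      by (simp_all add: upper_central_series_mono)
    moreover have "?Z n = ?Z (max m n)"
      using finite_subset[OF sub fin] \<open>?Z n \<subseteq> ?Z (max m n)\<close> n by (rule card_seteq)
    ultimately show ?thesis by simp
  qed
  then have "hypercentre G = ?Z n"
    unfolding hypercentre_def by blast
  then show ?thesis by (rule that)
qed

lemma p_group_nilpotent:
  assumes "Factorial_Ring.prime p" "order G = p ^ k"
  shows "nilpotent_group G"
proof -
  have "finite (carrier G)"
    using assms order_gt_0_iff_finite by (metis prime_gt_0_nat zero_less_power)
  then obtain n where n: "hypercentre G = upper_central_series G n"
    by (rule hypercentre_eq_upper_central_series)
  have "upper_central_series G n = carrier G"
  proof (rule ccontr)
    assume "upper_central_series G n \<noteq> carrier G"
    then obtain x where x: "x \<in> carrier G" "x \<notin> upper_central_series G n"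
      "\<And>y. y \<in> carrier G \<Longrightarrow> x \<otimes> y \<otimes> inv x \<otimes> inv y \<in> upper_central_series G n"
      using p_group_central_series_grows[OF assms upper_central_series_normal] by blast
    have "x \<in> upper_central_series G (Suc n)"
      using x(1,3) by simp
    with x(2) n show False
      unfolding hypercentre_def by blast
  qed
  then show ?thesis
    unfolding nilpotent_group_def using is_group by blast
qed

lemma p_subgroup_nilpotent:
  assumes "Factorial_Ring.prime p" "subgroup Q G" "card Q = p ^ k"
  shows "nilpotent_subgroup Q G"
  using group.p_group_nilpotent[OF subgroup_imp_group[OF assms(2)] assms(1), of k] assms(2,3)
  unfolding nilpotent_subgroup_def order_def by simp

end

subsection \<open>Sylow subgroups and normality\<close>

locale finite_group = group +
  assumes finite_carrier: "finite (carrier G)"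
begin

lemma finite_subgroup: "subgroup H G \<Longrightarrow> finite H"
  using finite_subset[OF subgroup.subset finite_carrier] .

lemma finite_group_restrict:
  assumes "subgroup H G"
  shows "finite_group (G\<lparr>carrier := H\<rparr>)"
  unfolding finite_group_def finite_group_axioms_def
  using subgroup_imp_group[OF assms] finite_subgroup[OF assms] by simp

lemma order_pos: "order G \<noteq> 0"
  using finite_carrier order_gt_0_iff_finite by simp

lemma card_subgroup_pos:
  assumes "subgroup H G"
  shows "card H \<noteq> 0"
  using finite_subgroup[OF assms] subgroup.one_closed[OF assms] by auto

lemma sylow_restrict_iff:
  assumes "subgroup H G"
  shows "sylow_subgroup p P (G\<lparr>carrier := H\<rparr>) \<longleftrightarrow>
    subgroup P G \<and> P \<subseteq> H \<and> card P = p ^ multiplicity p (card H)"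
  unfolding sylow_subgroup_def subgroup_restrict_iff[OF assms] order_def by simp

lemma conjugate_sylow:
  assumes "g \<in> carrier G" "sylow_subgroup p P G"
  shows "sylow_subgroup p (conjugate G g P) G"
  using assms conjugate_subgroup card_conjugate subgroup.subset
  unfolding sylow_subgroup_def by metis

lemma normal_sylow_contains:
  assumes p: "Factorial_Ring.prime p" and P: "sylow_subgroup p P G" "P \<lhd> G"
    and Q: "subgroup Q G" "card Q = p ^ k"
  shows "Q \<subseteq> P"
proof -
  obtain x where x: "x \<in> carrier G" "conjugate G x Q \<subseteq> P"
    using p_subgroup_conjugate_into_sylow[OF finite_carrier p P(1) Q] .
  have "Q \<subseteq> conjugate G (inv x) P"
    using x conjugate_subset_iff[OF x(1)] Q(1) normal_imp_subgroup[OF P(2)] subgroup.subset by blast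
  then show ?thesis
    using conjugate_normal[OF P(2)] x(1) by simp
qed

lemma sylow_of_subgroup:
  assumes p: "Factorial_Ring.prime p" and P: "sylow_subgroup p P G"
    and H: "subgroup H G" and PH: "P \<subseteq> H"
  shows "sylow_subgroup p P (G\<lparr>carrier := H\<rparr>)"
proof -
  have PG: "subgroup P G" and c: "card P = p ^ multiplicity p (order G)"
    using P unfolding sylow_subgroup_def by simp_all
  have "p ^ multiplicity p (order G) dvd card H"
    using card_subgroup_dvd[OF PG H PH] c by simp
  then have "multiplicity p (order G) \<le> multiplicity p (card H)"
    using p card_subgroup_pos[OF H] by (intro multiplicity_geI) auto
  moreover have "card H dvd order G"
    using card_subgroup_dvd[OF H subgroup_self subgroup.subset[OF H]] by (simp add: order_def)
  then have "multiplicity p (card H) \<le> multiplicity p (order G)"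
    using order_pos by (intro dvd_imp_multiplicity_le)
  ultimately show ?thesis
    unfolding sylow_restrict_iff[OF H] using PG PH c by simp
qed

text \<open>\<open>P\<close> is normal in its normalizer, so it contains every p-subgroup there. An
  element that normalizes the normalizer sends \<open>P\<close> to such a p-subgroup, hence fixes
  \<open>P\<close>.\<close>

lemma normalizer_sylow_self_normalizing:
  assumes p: "Factorial_Ring.prime p" and P: "sylow_subgroup p P G"
  shows "normalizer G (normalizer G P) = normalizer G P"
proof -
  have PG: "subgroup P G" and cP: "card P = p ^ multiplicity p (order G)"
    using P unfolding sylow_subgroup_def by simp_all
  let ?N = "normalizer G P"
  have N: "subgroup ?N G"
    using normalizer_imp_subgroup[OF subgroup.subset[OF PG]] .
  have N_eq: "?N = {g \<in> carrier G. conjugate G g P = P}"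
    using normalizer_eq[OF subgroup.subset[OF PG]] .
  have NN_eq: "normalizer G ?N = {g \<in> carrier G. conjugate G g ?N = ?N}"
    using normalizer_eq[OF subgroup.subset[OF N]] .
  have PN: "P \<subseteq> ?N"
    unfolding N_eq using subgroup.mem_carrier[OF PG] conjugate_self[OF PG] by blast
  have normal: "P \<lhd> G\<lparr>carrier := ?N\<rparr>"
    unfolding normal_restrict_iff[OF N] using PG PN N_eq by blast
  have "conjugate G g P = P" if g: "g \<in> carrier G" "conjugate G g ?N = ?N" for g
  proof -
    have "conjugate G g P \<subseteq> ?N"
      using conjugate_mono[OF PN, of g] g(2) by simp
    then have sub: "subgroup (conjugate G g P) (G\<lparr>carrier := ?N\<rparr>)"
      using conjugate_subgroup[OF g(1) PG] subgroup_restrict_iff[OF N] by simp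
    have card: "card (conjugate G g P) = p ^ multiplicity p (order G)"
      using card_conjugate[OF g(1) subgroup.subset[OF PG]] cP by simp
    have "conjugate G g P \<subseteq> P"
      using finite_group.normal_sylow_contains[OF finite_group_restrict[OF N] p
          sylow_of_subgroup[OF p P N PN] normal sub card] .
    then show ?thesis
      using card_subset_eq[OF finite_subgroup[OF PG]] card cP by simp
  qed
  then have "g \<in> ?N" if "g \<in> normalizer G ?N" for g
    using that N_eq NN_eq by (metis (mono_tags, lifting) mem_Collect_eq)
  moreover have "?N \<subseteq> normalizer G ?N"
    unfolding NN_eq using subgroup.mem_carrier[OF N] conjugate_self[OF N] by blast
  ultimately show ?thesis
    by (intro subset_antisym subsetI) blast+
qed

text \<open>A proper normalizer of \<open>P\<close> would grow, contrary to its being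
  self-normalizing.\<close>

lemma nilpotent_group_sylow_normal:
  assumes nil: "nilpotent_group G" and p: "Factorial_Ring.prime p" and P: "sylow_subgroup p P G"
  shows "P \<lhd> G"
proof -
  have PG: "subgroup P G"
    using P unfolding sylow_subgroup_def by simp
  let ?N = "normalizer G P"
  have N: "subgroup ?N G"
    using normalizer_imp_subgroup[OF subgroup.subset[OF PG]] .
  have "?N = carrier G"
  proof (rule ccontr)
    assume "?N \<noteq> carrier G"
    then have "?N \<subset> carrier G"
      using subgroup.subset[OF N] by blast
    then obtain x where "x \<in> carrier G" "x \<notin> ?N" "conjugate G x ?N = ?N"
      using nilpotent_normalizer_grows[OF _ N _ finite_subgroup[OF N]] nil
      unfolding nilpotent_group_iff by blast
    moreover from this have "x \<in> normalizer G ?N"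
      using normalizer_eq[OF subgroup.subset[OF N]] by blast
    ultimately show False
      using normalizer_sylow_self_normalizing[OF p P] by blast
  qed
  then show ?thesis
    unfolding normal_iff_conjugate using PG normalizer_eq[OF subgroup.subset[OF PG]] by blast
qed

lemma nilpotent_subgroup_sylow_normal:
  assumes H: "nilpotent_subgroup H G" and p: "Factorial_Ring.prime p"
    and P: "sylow_subgroup p P (G\<lparr>carrier := H\<rparr>)"
  shows "P \<lhd> G\<lparr>carrier := H\<rparr>"
  using H finite_group.nilpotent_group_sylow_normal[OF finite_group_restrict _ p P]
  unfolding nilpotent_subgroup_def by blast

text \<open>One Sylow subgroup per prime is enough: \<open>A \<inter> S\<close> then has order
  divisible by each full prime power in |A|, so it is all of \<open>A\<close>.\<close>

lemma subset_if_sylows_subset: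
  assumes A: "subgroup A G" and S: "subgroup S G"
    and syl: "\<And>p. Factorial_Ring.prime p \<Longrightarrow> p dvd card A \<Longrightarrow>
      \<exists>P. sylow_subgroup p P (G\<lparr>carrier := A\<rparr>) \<and> P \<subseteq> S"
  shows "A \<subseteq> S"
proof -
  have AS: "subgroup (A \<inter> S) G"
    using A S by (rule subgroup_Int)
  have "card A dvd card (A \<inter> S)"
  proof (rule multiplicity_le_imp_dvd)
    fix p :: nat assume p: "Factorial_Ring.prime p"
    show "multiplicity p (card A) \<le> multiplicity p (card (A \<inter> S))"
    proof (cases "p dvd card A")
      case True
      then obtain P where P: "subgroup P G" "P \<subseteq> A" "P \<subseteq> S" "card P = p ^ multiplicity p (card A)"
        using syl[OF p] unfolding sylow_restrict_iff[OF A] by blast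
      then have "p ^ multiplicity p (card A) dvd card (A \<inter> S)"
        using card_subgroup_dvd[OF P(1) AS] by simp
      then show ?thesis
        using p card_subgroup_pos[OF AS] by (intro multiplicity_geI) auto
    qed (simp add: not_dvd_imp_multiplicity_0)
  qed (rule card_subgroup_pos[OF A])
  then have "card A \<le> card (A \<inter> S)"
    using card_subgroup_pos[OF AS] by (intro dvd_imp_le) simp_all
  then have "A \<inter> S = A"
    using finite_subgroup[OF A] by (intro card_seteq) simp_all
  then show ?thesis by blast
qed

text \<open>A Sylow p-subgroup of \<open>H\<close> can be conjugated into \<open>P\<close> and stays
  in \<open>H\<close> by normality. So \<open>P \<inter> H\<close> is at least as large as it, and
  as a p-subgroup of \<open>H\<close> it is no larger.\<close>

lemma normal_sylow_Int:
  assumes p: "Factorial_Ring.prime p" and H: "H \<lhd> G" and P: "sylow_subgroup p P G"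
  shows "sylow_subgroup p (P \<inter> H) (G\<lparr>carrier := H\<rparr>)"
proof -
  have HG: "subgroup H G"
    using H by (rule normal_imp_subgroup)
  have PG: "subgroup P G" and cP: "card P = p ^ multiplicity p (order G)"
    using P unfolding sylow_subgroup_def by simp_all
  have PH: "subgroup (P \<inter> H) G"
    using PG HG by (rule subgroup_Int)
  have "finite (carrier (G\<lparr>carrier := H\<rparr>))"
    using finite_subgroup[OF HG] by simp
  then obtain S where "sylow_subgroup p S (G\<lparr>carrier := H\<rparr>)"
    using group.exists_sylow_subgroup[OF subgroup_imp_group[OF HG] _ p] by blast
  then have S: "subgroup S G" "S \<subseteq> H" and cS: "card S = p ^ multiplicity p (card H)"
    unfolding sylow_restrict_iff[OF HG] by simp_all
  obtain x where x: "x \<in> carrier G" "conjugate G x S \<subseteq> P"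
    using p_subgroup_conjugate_into_sylow[OF finite_carrier p P S(1) cS] .
  have "conjugate G x S \<subseteq> P \<inter> H"
    using x conjugate_mono[OF S(2), of x] conjugate_normal[OF H x(1)] by simp
  then have "card (conjugate G x S) \<le> card (P \<inter> H)"
    using finite_subgroup[OF PH] by (rule card_mono[rotated])
  then have le: "p ^ multiplicity p (card H) \<le> card (P \<inter> H)"
    using card_conjugate[OF x(1) subgroup.subset[OF S(1)]] cS by simp
  have "card (P \<inter> H) dvd p ^ multiplicity p (order G)"
    using card_subgroup_dvd[OF PH PG] cP by simp
  then obtain i where i: "card (P \<inter> H) = p ^ i"
    using p divides_primepow_nat by blast
  have "p ^ i dvd card H"
    using card_subgroup_dvd[OF PH HG] i by simp
  then have "i \<le> multiplicity p (card H)"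
    using p card_subgroup_pos[OF HG] by (intro multiplicity_geI) auto
  then have "p ^ i \<le> p ^ multiplicity p (card H)"
    using p prime_gt_0_nat by (intro power_increasing) (auto simp: Suc_le_eq)
  with le i show ?thesis
    unfolding sylow_restrict_iff[OF HG] using PH by simp
qed

end

subsection \<open>Subnormal subgroups\<close>

lemma subnormal_subgroup_imp_subgroup:
  "subnormal_subgroup K G \<Longrightarrow> group G \<Longrightarrow> subgroup K G"
proof (induction K G rule: subnormal_subgroup.induct)
  case (whole G)
  then show ?case by (rule group.subgroup_self)
next
  case (step K G H)
  then show ?case
    by (metis group.incl_subgroup normal_imp_subgroup)
qed

text \<open>The normal case is iterated down the subnormal chain: each intersection is the Sylow
  subgroup used for the next step.\<close>

lemma subnormal_sylow_Int:
  "subnormal_subgroup K G \<Longrightarrow> finite_group G \<Longrightarrow> Factorial_Ring.prime p \<Longrightarrow> sylow_subgroup p P G \<Longrightarrow>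
    sylow_subgroup p (P \<inter> K) (G\<lparr>carrier := K\<rparr>)"
proof (induction K G rule: subnormal_subgroup.induct)
  case (whole G)
  then have "P \<inter> carrier G = P"
    using subgroup.subset unfolding sylow_subgroup_def by blast
  with whole show ?case by simp
next
  case (step K G H)
  have G: "group G"
    using step.prems(1) finite_group.axioms(1) by blast
  have KG: "subgroup K G"
    using subnormal_subgroup_imp_subgroup[OF step.hyps(1) G] .
  have "sylow_subgroup p ((P \<inter> K) \<inter> H) (G\<lparr>carrier := K, carrier := H\<rparr>)"
    using finite_group.normal_sylow_Int[OF finite_group.finite_group_restrict[OF step.prems(1) KG]
        step.prems(2) step.hyps(2) step.IH[OF step.prems]] .
  moreover have "H \<subseteq> K"
    using subgroup.subset[OF normal_imp_subgroup[OF step.hyps(2)]] by simp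
  then have "(P \<inter> K) \<inter> H = P \<inter> H" by blast
  ultimately show ?case by simp
qed

subsection \<open>The p-cores and the Fitting subgroup\<close>

text \<open>For a prime \<open>p\<close> this is O_p(G), the largest normal p-subgroup. As an
  intersection it is normal because conjugation permutes the Sylow subgroups, and containment in it
  is tested one Sylow subgroup at a time.\<close>

definition p_core :: "('a, 'b) monoid_scheme \<Rightarrow> nat \<Rightarrow> 'a set" where
  "p_core G p = \<Inter>{P. sylow_subgroup p P G}"

context finite_group
begin

lemma sylow_exists: "Factorial_Ring.prime p \<Longrightarrow> \<exists>P. sylow_subgroup p P G"
  using exists_sylow_subgroup[OF finite_carrier] .

lemma p_core_subset_sylow: "sylow_subgroup p P G \<Longrightarrow> p_core G p \<subseteq> P"
  unfolding p_core_def by blast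

lemma p_core_subgroup:
  assumes "Factorial_Ring.prime p"
  shows "subgroup (p_core G p) G"
  unfolding p_core_def using sylow_exists[OF assms]
  by (intro subgroups_Inter) (auto simp: sylow_subgroup_def)

lemma p_core_normal:
  assumes p: "Factorial_Ring.prime p"
  shows "p_core G p \<lhd> G"
proof (rule normal_invI[OF p_core_subgroup[OF p]])
  fix g x assume g: "g \<in> carrier G" and x: "x \<in> p_core G p"
  have "g \<otimes> x \<otimes> inv g \<in> P" if P: "sylow_subgroup p P G" for P
  proof -
    have "x \<in> conjugate G (inv g) P"
      using p_core_subset_sylow[OF conjugate_sylow[OF inv_closed[OF g] P]] x by blast
    then have "g \<otimes> x \<otimes> inv g \<in> conjugate G g (conjugate G (inv g) P)"
      unfolding conjugate_def[of G g] by blast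
    then show ?thesis
      using conjugate_inv_conjugate(2)[OF g] P subgroup.subset
      unfolding sylow_subgroup_def by blast
  qed
  then show "g \<otimes> x \<otimes> inv g \<in> p_core G p"
    unfolding p_core_def by blast
qed

lemma card_p_core:
  assumes p: "Factorial_Ring.prime p"
  obtains k where "card (p_core G p) = p ^ k"
proof -
  obtain P where P: "sylow_subgroup p P G"
    using sylow_exists[OF p] by blast
  then have "card (p_core G p) dvd p ^ multiplicity p (order G)"
    using card_subgroup_dvd[OF p_core_subgroup[OF p] _ p_core_subset_sylow[OF P]]
    unfolding sylow_subgroup_def by metis
  then show ?thesis
    using p divides_primepow_nat that by blast
qed

lemma p_core_nilpotent:
  assumes "Factorial_Ring.prime p"
  shows "nilpotent_subgroup (p_core G p) G"
  using card_p_core[OF assms] p_subgroup_nilpotent[OF assms p_core_subgroup[OF assms]] by blast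

text \<open>Every Sylow p-subgroup of \<open>G\<close> meets \<open>Q\<close> in a Sylow p-subgroup
  of \<open>Q\<close>, which is \<open>Q\<close> itself.\<close>

lemma subnormal_p_subgroup_subset_p_core:
  assumes p: "Factorial_Ring.prime p" and Q: "subnormal_subgroup Q G" "card Q = p ^ k"
  shows "Q \<subseteq> p_core G p"
proof -
  have QG: "subgroup Q G"
    using subnormal_subgroup_imp_subgroup[OF Q(1) is_group] .
  have "Q \<subseteq> P" if P: "sylow_subgroup p P G" for P
  proof -
    have "card (P \<inter> Q) = p ^ multiplicity p (card Q)"
      using subnormal_sylow_Int[OF Q(1) finite_group_axioms p P] unfolding sylow_restrict_iff[OF QG]
      by blast
    also have "\<dots> = card Q"
      using Q(2) p by simp
    finally have "P \<inter> Q = Q"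
      using finite_subgroup[OF QG] by (intro card_subset_eq) simp_all
    then show ?thesis by blast
  qed
  then show ?thesis
    unfolding p_core_def by blast
qed

text \<open>A Sylow subgroup of \<open>A\<close> is normal in \<open>A\<close>, hence subnormal in
  \<open>G\<close>, hence inside a p-core. The target \<open>S\<close> is left open because it is
  taken to be the Fitting subgroup as well as subgroups that are to contain it.\<close>

lemma subnormal_nilpotent_subset:
  assumes A: "nilpotent_subgroup A G" "subnormal_subgroup A G" and S: "subgroup S G"
    and core: "\<And>p. Factorial_Ring.prime p \<Longrightarrow> p_core G p \<subseteq> S"
  shows "A \<subseteq> S"
proof -
  have AG: "subgroup A G"
    using A(1) unfolding nilpotent_subgroup_def by simp
  show ?thesis
  proof (rule subset_if_sylows_subset[OF AG S])
    fix p :: nat assume p: "Factorial_Ring.prime p"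
    obtain P where P: "sylow_subgroup p P (G\<lparr>carrier := A\<rparr>)"
      using finite_group.sylow_exists[OF finite_group_restrict[OF AG] p] by blast
    have "subnormal_subgroup P G"
      using A(2) nilpotent_subgroup_sylow_normal[OF A(1) p P] by (rule subnormal_subgroup.step)
    then have "P \<subseteq> p_core G p"
      using P unfolding sylow_restrict_iff[OF AG]
      by (intro subnormal_p_subgroup_subset_p_core[OF p]) auto
    with P core[OF p] show "\<exists>P. sylow_subgroup p P (G\<lparr>carrier := A\<rparr>) \<and> P \<subseteq> S"
      by blast
  qed
qed

lemma normal_imp_subnormal: "N \<lhd> G \<Longrightarrow> subnormal_subgroup N G"
  by (rule subnormal_subgroup.step[OF subnormal_subgroup.whole]) simp

lemma nilpotent_normal_subset_fitting:
  assumes "N \<lhd> G" "nilpotent_subgroup N G"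
  shows "N \<subseteq> fitting_subgroup G"
  unfolding fitting_subgroup_def using assms by (auto intro: generate.incl)

lemma fitting_normal: "fitting_subgroup G \<lhd> G"
  unfolding fitting_subgroup_def
proof (rule normal_generateI)
  show "\<Union>{N. N \<lhd> G \<and> nilpotent_subgroup N G} \<subseteq> carrier G"
    using normal_imp_subgroup subgroup.subset by blast
  show "g \<otimes> h \<otimes> inv g \<in> \<Union>{N. N \<lhd> G \<and> nilpotent_subgroup N G}"
    if "h \<in> \<Union>{N. N \<lhd> G \<and> nilpotent_subgroup N G}" "g \<in> carrier G" for h g
    using that normal_invE(2) by blast
qed

lemma fitting_subgroup_subgroup: "subgroup (fitting_subgroup G) G"
  using fitting_normal by (rule normal_imp_subgroup)

lemma p_core_subset_fitting: "Factorial_Ring.prime p \<Longrightarrow> p_core G p \<subseteq> fitting_subgroup G"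
  by (rule nilpotent_normal_subset_fitting[OF p_core_normal p_core_nilpotent])

lemma subnormal_nilpotent_subset_fitting:
  "nilpotent_subgroup A G \<Longrightarrow> subnormal_subgroup A G \<Longrightarrow> A \<subseteq> fitting_subgroup G"
  using subnormal_nilpotent_subset[OF _ _ fitting_subgroup_subgroup p_core_subset_fitting] .

text \<open>Together with \<open>p_core_subset_fitting\<close> this says that the p-cores generate
  the Fitting subgroup; all upper bounds for it below are obtained in this form.\<close>

lemma fitting_subset_if_p_cores_subset:
  assumes S: "subgroup S G" and core: "\<And>p. Factorial_Ring.prime p \<Longrightarrow> p_core G p \<subseteq> S"
  shows "fitting_subgroup G \<subseteq> S"
  unfolding fitting_subgroup_def
proof (rule generate_subgroup_incl[OF _ S])
  show "\<Union>{N. N \<lhd> G \<and> nilpotent_subgroup N G} \<subseteq> S"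
    using subnormal_nilpotent_subset[OF _ normal_imp_subnormal S core] by blast
qed

lemma p_cores_commute:
  assumes p: "Factorial_Ring.prime p" and q: "Factorial_Ring.prime q" and "p \<noteq> q"
    and x: "x \<in> p_core G p" and y: "y \<in> p_core G q"
  shows "x \<otimes> y = y \<otimes> x"
proof -
  obtain i j where "card (p_core G p) = p ^ i" "card (p_core G q) = q ^ j"
    using card_p_core[OF p] card_p_core[OF q] by metis
  then have "coprime (card (p_core G p)) (card (p_core G q))"
    using primes_coprime[OF p q \<open>p \<noteq> q\<close>] by simp
  then have "p_core G p \<inter> p_core G q = {\<one>}"
    by (rule Int_eq_one_of_coprime[OF p_core_subgroup[OF p] p_core_subgroup[OF q]])
  then show ?thesis
    by (rule normals_commute[OF p_core_normal[OF p] p_core_normal[OF q] _ x y])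
qed

end

section \<open>Centralizers and products with a normal subgroup\<close>

context group
begin

lemma centralizer_of_normal:
  assumes K: "K \<lhd> G"
  shows "{c \<in> carrier G. \<forall>k\<in>K. c \<otimes> k = k \<otimes> c} \<lhd> G" (is "?C \<lhd> G")
proof -
  have Kc: "k \<in> carrier G" if "k \<in> K" for k
    by (rule subgroup.mem_carrier[OF normal_imp_subgroup[OF K] that])
  have "subgroup ?C G"
  proof (rule subgroupI)
    show "?C \<noteq> {}"
      using Kc by (auto intro!: exI[of _ \<one>])
  next
    fix c assume c: "c \<in> ?C"
    have "inv c \<otimes> k = k \<otimes> inv c" if k: "k \<in> K" for k
    proof -
      have "inv c \<otimes> (k \<otimes> c) \<otimes> inv c = inv c \<otimes> (c \<otimes> k) \<otimes> inv c"
        using c k by simp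
      then show ?thesis
        using c Kc[OF k] by (simp add: group_norm)
    qed
    with c show "inv c \<in> ?C" by simp
  next
    fix c d assume c: "c \<in> ?C" and d: "d \<in> ?C"
    have "c \<otimes> d \<otimes> k = k \<otimes> (c \<otimes> d)" if k: "k \<in> K" for k
    proof -
      have cd: "c \<in> carrier G" "d \<in> carrier G" "c \<otimes> k = k \<otimes> c" "d \<otimes> k = k \<otimes> d"
        using c d k by simp_all
      have "c \<otimes> d \<otimes> k = c \<otimes> (d \<otimes> k)"
        using cd(1,2) Kc[OF k] by (simp add: m_assoc)
      also have "\<dots> = c \<otimes> k \<otimes> d"
        unfolding cd(4) using cd(1,2) Kc[OF k] by (simp add: m_assoc)
      also have "\<dots> = k \<otimes> (c \<otimes> d)"
        unfolding cd(3) using cd(1,2) Kc[OF k] by (simp add: m_assoc)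
      finally show ?thesis .
    qed
    with c d show "c \<otimes> d \<in> ?C" by simp
  qed auto
  moreover have "g \<otimes> c \<otimes> inv g \<in> ?C" if g: "g \<in> carrier G" and c: "c \<in> ?C" for g c
  proof -
    have "g \<otimes> c \<otimes> inv g \<otimes> k = k \<otimes> (g \<otimes> c \<otimes> inv g)" if k: "k \<in> K" for k
    proof -
      have "inv g \<otimes> k \<otimes> inv (inv g) \<in> K"
        using g k by (intro normal_invE(2)[OF K] inv_closed)
      then have "c \<otimes> (inv g \<otimes> k \<otimes> g) = (inv g \<otimes> k \<otimes> g) \<otimes> c"
        using c g by simp
      then have "g \<otimes> (c \<otimes> (inv g \<otimes> k \<otimes> g)) \<otimes> inv g = g \<otimes> ((inv g \<otimes> k \<otimes> g) \<otimes> c) \<otimes> inv g"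
        by (rule arg_cong)
      then show ?thesis
        using g c Kc[OF k] by (simp add: group_norm)
    qed
    with g c show ?thesis by simp
  qed
  ultimately show ?thesis
    unfolding normal_inv_iff by blast
qed

lemma normal_set_mult_subgroup:
  assumes "N \<lhd> G" "subgroup H G"
  shows "subgroup (N <#> H) G"
  using assms second_isomorphism_grp.normal_set_mult_subgroup
  unfolding second_isomorphism_grp_def second_isomorphism_grp_axioms_def by blast

lemma subset_set_mult:
  assumes "subgroup A G" "subgroup B G"
  shows "A \<subseteq> A <#> B" and "B \<subseteq> A <#> B"
proof -
  show "A \<subseteq> A <#> B"
  proof
    fix a assume "a \<in> A"
    then have "a = a \<otimes> \<one>"
      using subgroup.mem_carrier[OF assms(1)] by simp
    with \<open>a \<in> A\<close> subgroup.one_closed[OF assms(2)] show "a \<in> A <#> B"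
      unfolding set_mult_def by blast
  qed
  show "B \<subseteq> A <#> B"
  proof
    fix b assume "b \<in> B"
    then have "b = \<one> \<otimes> b"
      using subgroup.mem_carrier[OF assms(2)] by simp
    with \<open>b \<in> B\<close> subgroup.one_closed[OF assms(1)] show "b \<in> A <#> B"
      unfolding set_mult_def by blast
  qed
qed

end

section \<open>Nilpotency of the Fitting subgroup and its hypercentral part\<close>

context finite_group
begin

text \<open>The p-core for \<open>p\<close> lies in \<open>H\<close>, and those for all other primes
  centralize it.\<close>

lemma fitting_subset_centralizer_mult:
  assumes p: "Factorial_Ring.prime p" and H: "subgroup H G" and sub: "p_core G p \<subseteq> H"
  shows "fitting_subgroup G \<subseteq> {c \<in> carrier G. \<forall>k\<in>p_core G p. c \<otimes> k = k \<otimes> c} <#> H"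
    (is "_ \<subseteq> ?C <#> H")
proof (rule fitting_subset_if_p_cores_subset)
  have C: "?C \<lhd> G"
    by (rule centralizer_of_normal[OF p_core_normal[OF p]])
  then show "subgroup (?C <#> H) G"
    using H by (rule normal_set_mult_subgroup)
  note subs = subset_set_mult[OF normal_imp_subgroup[OF C] H]
  fix q :: nat assume q: "Factorial_Ring.prime q"
  show "p_core G q \<subseteq> ?C <#> H"
  proof (cases "q = p")
    case True
    then show ?thesis
      using sub subs(2) by blast
  next
    case False
    then have "p_core G q \<subseteq> ?C"
      using p_cores_commute[OF q p] subgroup.mem_carrier[OF p_core_subgroup[OF q]] by blast
    then show ?thesis
      using subs(1) by blast
  qed
qed

text \<open>Modulo its centralizer, \<open>L\<close> acts on the p-core through the nilpotent group
  \<open>H\<close>. It is used twice: with \<open>L\<close> the Fitting subgroup and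
  \<open>H\<close> the p-core itself, for nilpotency of the former, and with \<open>L\<close> the
  whole group and \<open>H\<close> the nilpotent supplement.\<close>

lemma p_core_subset_hypercentre:
  assumes p: "Factorial_Ring.prime p" and H: "nilpotent_subgroup H G" and KH: "p_core G p \<subseteq> H"
    and L: "subgroup L G"
    and dec: "L \<subseteq> {c \<in> carrier G. \<forall>k\<in>p_core G p. c \<otimes> k = k \<otimes> c} <#> H"
  shows "p_core G p \<inter> L \<subseteq> hypercentre (G\<lparr>carrier := L\<rparr>)"
proof
  fix x assume x: "x \<in> p_core G p \<inter> L"
  obtain n where HG: "subgroup H G" and n: "H \<subseteq> upper_central_series (G\<lparr>carrier := H\<rparr>) n"
    using H unfolding nilpotent_subgroup_iff by blast
  have "\<exists>c\<in>carrier G. \<exists>h\<in>H. g = c \<otimes> h \<and> (\<forall>k\<in>p_core G p. c \<otimes> k = k \<otimes> c)" if "g \<in> L" for g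
    using that dec unfolding set_mult_def by blast
  then have "x \<in> upper_central_series (G\<lparr>carrier := L\<rparr>) n"
    using x KH n by (intro upper_central_series_transfer[OF p_core_normal[OF p] HG L]) blast+
  then show "x \<in> hypercentre (G\<lparr>carrier := L\<rparr>)"
    unfolding hypercentre_def by blast
qed

text \<open>Every p-core lies in the hypercentre of the Fitting subgroup, and the p-cores generate
  it; so it equals its own hypercentre. Products of two nilpotent normal subgroups need not be
  examined.\<close>

lemma fitting_nilpotent: "nilpotent_subgroup (fitting_subgroup G) G"
proof -
  let ?F = "fitting_subgroup G"
  note F = fitting_subgroup_subgroup
  interpret F: group "G\<lparr>carrier := ?F\<rparr>"
    using F by (rule subgroup_imp_group)
  obtain n where n: "hypercentre (G\<lparr>carrier := ?F\<rparr>) = upper_central_series (G\<lparr>carrier := ?F\<rparr>) n"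
    using F.hypercentre_eq_upper_central_series finite_subgroup[OF F] by auto
  have "subgroup (hypercentre (G\<lparr>carrier := ?F\<rparr>)) (G\<lparr>carrier := ?F\<rparr>)"
    unfolding n using F.upper_central_series_normal by (rule normal_imp_subgroup)
  then have "subgroup (hypercentre (G\<lparr>carrier := ?F\<rparr>)) G"
    by (rule incl_subgroup[OF F])
  then have "?F \<subseteq> hypercentre (G\<lparr>carrier := ?F\<rparr>)"
  proof (rule fitting_subset_if_p_cores_subset)
    fix p :: nat assume p: "Factorial_Ring.prime p"
    show "p_core G p \<subseteq> hypercentre (G\<lparr>carrier := ?F\<rparr>)"
      using p_core_subset_hypercentre[OF p p_core_nilpotent[OF p] order_refl F
          fitting_subset_centralizer_mult[OF p p_core_subgroup[OF p] order_refl]]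
        p_core_subset_fitting[OF p] by blast
  qed
  then show ?thesis
    unfolding nilpotent_subgroup_iff using F n by blast
qed

lemma hypercentre_normal: "hypercentre G \<lhd> G"
  using hypercentre_eq_upper_central_series[OF finite_carrier] upper_central_series_normal by metis

lemma hypercentre_subset_fitting: "hypercentre G \<subseteq> fitting_subgroup G"
  using hypercentre_eq_upper_central_series[OF finite_carrier] hypercentre_normal
    nilpotent_upper_central_series nilpotent_normal_subset_fitting by metis

end

subsection \<open>Maximal nilpotent subgroups\<close>

context group
begin

lemma cyclic_subgroup_nilpotent:
  assumes a: "a \<in> carrier G"
  shows "nilpotent_subgroup (generate G {a}) G"
proof -
  have sub: "subgroup (generate G {a}) G"
    using a by (intro generate_is_subgroup) simp
  have "x \<otimes> y \<otimes> inv x \<otimes> inv y = \<one>" if "x \<in> generate G {a}" "y \<in> generate G {a}" for x y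
  proof -
    obtain i j :: int where ij: "x = a [^] i" "y = a [^] j"
      using \<open>x \<in> _\<close> \<open>y \<in> _\<close> unfolding generate_pow[OF a] by blast
    have "x \<otimes> y = y \<otimes> x"
      unfolding ij using int_pow_mult[OF a, of i j] int_pow_mult[OF a, of j i]
      by (simp add: add.commute)
    moreover have "x \<in> carrier G" "y \<in> carrier G"
      using ij a by simp_all
    ultimately show ?thesis
      by (simp add: group_norm)
  qed
  then have "generate G {a} \<subseteq> upper_central_series (G\<lparr>carrier := generate G {a}\<rparr>) (Suc 0)"
    unfolding upper_central_series_restrict_Suc[OF sub] by (intro subsetI) simp
  with sub show ?thesis
    unfolding nilpotent_subgroup_iff by blast
qed

lemma conjugate_maximal_nilpotent_subgroup:
  assumes g: "g \<in> carrier G" and H: "maximal_nilpotent_subgroup H G"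
  shows "maximal_nilpotent_subgroup (conjugate G g H) G"
proof -
  have Hn: "nilpotent_subgroup H G" and max: "\<And>B. nilpotent_subgroup B G \<Longrightarrow> H \<subseteq> B \<Longrightarrow> B = H"
    using H unfolding maximal_nilpotent_subgroup_def by blast+
  have Hc: "H \<subseteq> carrier G"
    using Hn subgroup.subset unfolding nilpotent_subgroup_def by blast
  have "B = conjugate G g H" if B: "nilpotent_subgroup B G" "conjugate G g H \<subseteq> B" for B
  proof -
    have Bc: "B \<subseteq> carrier G"
      using B(1) subgroup.subset unfolding nilpotent_subgroup_def by blast
    have "H \<subseteq> conjugate G (inv g) B"
      using conjugate_subset_iff[OF g Hc Bc] B(2) by simp
    then have "conjugate G (inv g) B = H"
      by (intro max conjugate_nilpotent_subgroup[OF inv_closed[OF g] B(1)])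
    then show ?thesis
      using conjugate_inv_conjugate(2)[OF g Bc] by simp
  qed
  then show ?thesis
    unfolding maximal_nilpotent_subgroup_def using conjugate_nilpotent_subgroup[OF g Hn] by blast
qed

end

lemma (in finite_group) nilpotent_subset_maximal:
  assumes A: "nilpotent_subgroup A G"
  obtains M where "maximal_nilpotent_subgroup M G" "A \<subseteq> M"
proof -
  let ?P = "\<lambda>M. nilpotent_subgroup M G \<and> A \<subseteq> M"
  have "card M < Suc (card (carrier G))" if "?P M" for M
    using that card_mono[OF finite_carrier subgroup.subset, of M] unfolding nilpotent_subgroup_def
    by simp
  then obtain M where M: "?P M" and max: "\<And>B. ?P B \<Longrightarrow> card B \<le> card M"
    using ex_has_greatest_nat[of ?P A card "Suc (card (carrier G))"] A by blast
  have "B = M" if B: "nilpotent_subgroup B G" "M \<subseteq> B" for B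
  proof -
    have "finite B"
      using B(1) finite_subgroup unfolding nilpotent_subgroup_def by blast
    moreover have "card B \<le> card M"
      using max B M by blast
    ultimately show ?thesis
      using card_seteq[OF _ B(2)] by simp
  qed
  with M that show ?thesis
    unfolding maximal_nilpotent_subgroup_def by blast
qed

subsection \<open>Weakly semi-nilpotent groups\<close>

locale wsn_group = finite_group +
  assumes wsn: "weakly_semi_nilpotent G"
begin

abbreviation fit :: "'a set" where "fit \<equiv> fitting_subgroup G"

definition outer :: "'a set \<Rightarrow> bool" where
  "outer H \<longleftrightarrow> maximal_nilpotent_subgroup H G \<and> \<not> H \<subseteq> fit"

lemma outer_nilpotent: "outer H \<Longrightarrow> nilpotent_subgroup H G"
  unfolding outer_def maximal_nilpotent_subgroup_def by blast

lemma outer_subgroup: "outer H \<Longrightarrow> subgroup H G"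
  using outer_nilpotent unfolding nilpotent_subgroup_def by blast

lemma outer_maximal: "outer H \<Longrightarrow> nilpotent_subgroup B G \<Longrightarrow> H \<subseteq> B \<Longrightarrow> B = H"
  unfolding outer_def maximal_nilpotent_subgroup_def by blast

text \<open>The one point where the hypothesis \<open>wsn\<close> enters: outside \<open>fit\<close>
  a nilpotent subgroup cannot be subnormal.\<close>

lemma normalizer_nilpotent:
  "nilpotent_subgroup A G \<Longrightarrow> \<not> A \<subseteq> fit \<Longrightarrow> nilpotent_subgroup (normalizer G A) G"
  using wsn subnormal_nilpotent_subset_fitting unfolding weakly_semi_nilpotent_def by blast

lemma nilpotent_subset_outer:
  assumes "nilpotent_subgroup A G" "\<not> A \<subseteq> fit"
  obtains H where "outer H" "A \<subseteq> H"
  using nilpotent_subset_maximal[OF assms(1)] assms(2) unfolding outer_def by blast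

lemma subgroup_subset_normalizer:
  assumes "subgroup A G"
  shows "A \<subseteq> normalizer G A"
  unfolding normalizer_eq[OF subgroup.subset[OF assms]]
  using conjugate_self[OF assms] subgroup.mem_carrier[OF assms] by blast

lemma outer_self_normalizing:
  assumes H: "outer H"
  shows "normalizer G H = H"
  using H by (intro outer_maximal[OF H] normalizer_nilpotent outer_nilpotent
      subgroup_subset_normalizer outer_subgroup) (simp_all add: outer_def)

text \<open>Induction towards larger intersections. The normalizer of the intersection
  \<open>?D\<close> is nilpotent, so it lies in an outer \<open>M\<close>. If
  \<open>H \<noteq> K\<close>, then \<open>?D\<close> is proper in both, its normalizer grows in
  both, and \<open>M\<close> meets each of them in more than \<open>?D\<close>; by induction
  \<open>M\<close> equals both.\<close>

lemma outer_Int_subset_fit: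
  "outer H \<Longrightarrow> outer K \<Longrightarrow> \<not> H \<inter> K \<subseteq> fit \<Longrightarrow> H = K"
proof (induction "card (carrier G) - card (H \<inter> K)" arbitrary: H K rule: less_induct)
  case less
  let ?D = "H \<inter> K"
  have HG: "subgroup H G" and KG: "subgroup K G"
    using less.prems(1,2) by (simp_all add: outer_subgroup)
  have DG: "subgroup ?D G"
    using HG KG by (rule subgroup_Int)
  have D: "nilpotent_subgroup ?D G"
    using outer_nilpotent[OF less.prems(1)] DG by (rule nilpotent_subgroup_mono) simp
  have N: "nilpotent_subgroup (normalizer G ?D) G"
    using D less.prems(3) by (rule normalizer_nilpotent)
  have DN: "?D \<subseteq> normalizer G ?D"
    using DG by (rule subgroup_subset_normalizer)
  then have "\<not> normalizer G ?D \<subseteq> fit"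
    using less.prems(3) by blast
  with N obtain M where M: "outer M" "normalizer G ?D \<subseteq> M"
    by (rule nilpotent_subset_outer)
  show ?case
  proof (rule ccontr)
    assume ne: "H \<noteq> K"
    \<comment> \<open>To be used with \<open>H\<close> and with \<open>K\<close> in place of
      \<open>L\<close>.\<close>
    have eq: "M = L" if L: "outer L" "?D \<subset> L" for L
    proof (rule less.hyps)
      have LG: "subgroup L G"
        using L(1) by (rule outer_subgroup)
      obtain x where x: "x \<in> L" "x \<notin> ?D" "conjugate G x ?D = ?D"
        using nilpotent_normalizer_grows[OF outer_nilpotent[OF L(1)] DG L(2) finite_subgroup[OF DG]] .
      have "x \<in> normalizer G ?D"
        unfolding normalizer_eq[OF subgroup.subset[OF DG]]
        using x(3) subgroup.mem_carrier[OF LG x(1)] by simp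
      then have sub: "?D \<subset> M \<inter> L"
        using x(1,2) L(2) M(2) DN by blast
      have MLG: "subgroup (M \<inter> L) G"
        using outer_subgroup[OF M(1)] LG by (rule subgroup_Int)
      have "card ?D < card (M \<inter> L)"
        using finite_subgroup[OF MLG] sub by (rule psubset_card_mono)
      moreover have "card (M \<inter> L) \<le> card (carrier G)"
        using finite_carrier subgroup.subset[OF MLG] by (rule card_mono)
      ultimately show "card (carrier G) - card (M \<inter> L) < card (carrier G) - card ?D"
        by linarith
      show "\<not> M \<inter> L \<subseteq> fit"
        using sub less.prems(3) by blast
    qed (use M L in blast)+
    have "?D \<noteq> H"
      using ne outer_maximal[OF less.prems(1) outer_nilpotent[OF less.prems(2)]] by blast
    moreover have "?D \<noteq> K"
      using ne outer_maximal[OF less.prems(2) outer_nilpotent[OF less.prems(1)]] by blast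
    ultimately have "M = H" "M = K"
      using eq less.prems(1,2) by blast+
    with ne show False by blast
  qed
qed

section \<open>Counting the conjugates of outer subgroups\<close>

lemma conjugate_subset_fit_iff:
  assumes "g \<in> carrier G" "A \<subseteq> carrier G"
  shows "conjugate G g A \<subseteq> fit \<longleftrightarrow> A \<subseteq> fit"
  using conjugate_subset_iff[OF assms subgroup.subset[OF fitting_subgroup_subgroup]]
    conjugate_normal[OF fitting_normal inv_closed[OF assms(1)]] by simp

lemma conjugate_mem_fit_iff:
  assumes "g \<in> carrier G" "x \<in> carrier G"
  shows "g \<otimes> x \<otimes> inv g \<in> fit \<longleftrightarrow> x \<in> fit"
  using conjugate_subset_fit_iff[of g "{x}"] assms unfolding conjugate_def by simp

lemma conjugate_outer:
  assumes g: "g \<in> carrier G" and H: "outer H"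
  shows "outer (conjugate G g H)"
  using H conjugate_maximal_nilpotent_subgroup[OF g]
    conjugate_subset_fit_iff[OF g subgroup.subset[OF outer_subgroup[OF H]]]
  unfolding outer_def by blast

text \<open>The union of the conjugates of \<open>H - fit\<close>, written as an image of pairs so
  that its size can be read off from the fibres.\<close>

definition sweep :: "'a set \<Rightarrow> 'a set" where
  "sweep H = (\<lambda>(x, h). x \<otimes> h \<otimes> inv x) ` (carrier G \<times> (H - fit))"

lemma sweep_subset:
  assumes "outer H"
  shows "sweep H \<subseteq> carrier G - fit"
proof
  fix y assume "y \<in> sweep H"
  then obtain x h where xh: "x \<in> carrier G" "h \<in> H" "h \<notin> fit" "y = x \<otimes> h \<otimes> inv x"
    unfolding sweep_def by auto
  moreover have "h \<in> carrier G"
    using outer_subgroup[OF assms] xh(2) by (rule subgroup.mem_carrier)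
  ultimately show "y \<in> carrier G - fit"
    using conjugate_mem_fit_iff by simp
qed

text \<open>Two conjugates sharing an element outside \<open>fit\<close> coincide. With
  \<open>K = H\<close> this determines the fibres of \<open>sweep\<close>; in general it turns
  overlapping sweeps into conjugacy.\<close>

lemma conjugates_of_outer_meet:
  assumes H: "outer H" and K: "outer K" and x: "x \<in> carrier G" and z: "z \<in> carrier G"
    and h: "h \<in> H" "h \<notin> fit" and k: "k \<in> K" and eq: "x \<otimes> h \<otimes> inv x = z \<otimes> k \<otimes> inv z"
  shows "conjugate G (inv z \<otimes> x) H = K"
proof -
  have Hc: "H \<subseteq> carrier G" and Kc: "K \<subseteq> carrier G"
    using subgroup.subset[OF outer_subgroup[OF H]] subgroup.subset[OF outer_subgroup[OF K]] .
  have "x \<otimes> h \<otimes> inv x \<in> conjugate G x H"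
    using h(1) unfolding conjugate_def by (rule imageI)
  moreover have "x \<otimes> h \<otimes> inv x \<in> conjugate G z K"
    unfolding eq using k unfolding conjugate_def by (rule imageI)
  moreover have "x \<otimes> h \<otimes> inv x \<notin> fit"
    using conjugate_mem_fit_iff[OF x subsetD[OF Hc h(1)]] h(2) by simp
  ultimately have "\<not> conjugate G x H \<inter> conjugate G z K \<subseteq> fit"
    by blast
  then have "conjugate G x H = conjugate G z K"
    by (rule outer_Int_subset_fit[OF conjugate_outer[OF x H] conjugate_outer[OF z K]])
  then have "conjugate G (inv z) (conjugate G x H) = K"
    using conjugate_inv_conjugate(1)[OF z Kc] by simp
  then show ?thesis
    using x z Hc by (simp add: conjugate_mult)
qed

text \<open>The fibre over \<open>x \<otimes> h \<otimes> inv x\<close> is parametrized by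
  \<open>H\<close> through
  \<open>k \<mapsto> (x \<otimes> k, inv k \<otimes> h \<otimes> k)\<close>; nothing else occurs
  because \<open>H\<close> is self-normalizing. In other words, there are |G:H| conjugates with
  disjoint parts outside \<open>fit\<close>.\<close>

lemma card_sweep:
  assumes H: "outer H"
  shows "card (carrier G) * card (H - fit) = card H * card (sweep H)"
proof -
  let ?f = "\<lambda>(x, h). x \<otimes> h \<otimes> inv x"
  let ?A = "carrier G \<times> (H - fit)"
  have HG: "subgroup H G"
    using H by (rule outer_subgroup)
  note Hc = subgroup.mem_carrier[OF HG]
  have "card {z \<in> ?A. ?f z = y} = card H" if y: "y \<in> ?f ` ?A" for y
  proof -
    obtain x h where x: "x \<in> carrier G" and h: "h \<in> H" "h \<notin> fit" and y_eq: "y = x \<otimes> h \<otimes> inv x"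
      using y by auto
    have hc: "h \<in> carrier G"
      using h(1) by (rule Hc)
    let ?g = "\<lambda>k. (x \<otimes> k, inv k \<otimes> h \<otimes> k)"
    have "{z \<in> ?A. ?f z = y} = ?g ` H"
    proof (intro subset_antisym subsetI)
      fix z assume "z \<in> {z \<in> ?A. ?f z = y}"
      then obtain x' h' where z: "z = (x', h')" "x' \<in> carrier G" "h' \<in> H" "h' \<notin> fit"
        "x' \<otimes> h' \<otimes> inv x' = x \<otimes> h \<otimes> inv x"
        using y_eq by auto
      have h'c: "h' \<in> carrier G"
        using z(3) by (rule Hc)
      \<comment> \<open>This element normalizes \<open>H\<close>, since the two conjugates of
        \<open>H\<close> share an element outside \<open>fit\<close>.\<close>
      let ?k = "inv x \<otimes> x'"
      have "conjugate G ?k H = H"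
        using conjugates_of_outer_meet[OF H H z(2) x z(3,4) h(1) z(5)] .
      then have "?k \<in> normalizer G H"
        unfolding normalizer_eq[OF subgroup.subset[OF HG]] using x z(2) by simp
      then have kH: "?k \<in> H"
        unfolding outer_self_normalizing[OF H] .
      have "inv x' \<otimes> (x' \<otimes> h' \<otimes> inv x') \<otimes> x' = inv x' \<otimes> (x \<otimes> h \<otimes> inv x) \<otimes> x'"
        by (simp only: z(5))
      then have "h' = inv ?k \<otimes> h \<otimes> ?k"
        using x z(2) hc h'c by (simp add: group_norm)
      moreover have "x' = x \<otimes> ?k"
        using x z(2) by (simp add: group_norm)
      ultimately have "z = ?g ?k"
        unfolding z(1) prod.inject by blast
      with kH show "z \<in> ?g ` H"
        by (rule rev_image_eqI)
    next
      fix z assume "z \<in> ?g ` H"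
      then obtain k where k: "k \<in> H" "z = ?g k" by blast
      have kc: "k \<in> carrier G"
        using k(1) by (rule Hc)
      have "inv k \<otimes> h \<otimes> k \<in> H"
        by (intro subgroup.m_closed[OF HG] subgroup.m_inv_closed[OF HG] k(1) h(1))
      moreover have "inv k \<otimes> h \<otimes> k \<notin> fit"
        using conjugate_mem_fit_iff[of "inv k" h] kc hc h(2) by simp
      moreover have "(x \<otimes> k) \<otimes> (inv k \<otimes> h \<otimes> k) \<otimes> inv (x \<otimes> k) = y"
        using x kc hc y_eq by (simp add: group_norm)
      ultimately show "z \<in> {z \<in> ?A. ?f z = y}"
        using k(2) x kc by simp
    qed
    moreover have "inj_on ?g H"
      using x Hc by (intro inj_onI) simp
    ultimately show ?thesis
      by (simp add: card_image)
  qed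
  then have "card ?A = card H * card (?f ` ?A)"
    using finite_carrier finite_subgroup[OF HG] by (intro card_eq_fibre_card_times) simp_all
  then show ?thesis
    unfolding sweep_def by (simp add: card_cartesian_product)
qed

text \<open>The 2 is the least index that the proper subgroup \<open>H \<inter> fit\<close> can have
  in \<open>H\<close>; thus \<open>H - fit\<close> is at least half of \<open>H\<close>, and
  \<open>card_sweep\<close> carries the proportion over to \<open>G\<close>.\<close>

lemma card_le_twice_sweep:
  assumes H: "outer H"
  shows "card (carrier G) \<le> 2 * card (sweep H)"
proof -
  have HG: "subgroup H G"
    using H by (rule outer_subgroup)
  have HF: "subgroup (H \<inter> fit) G"
    using HG fitting_subgroup_subgroup by (rule subgroup_Int)
  have "card (H \<inter> fit) dvd card H"
    using HF HG by (rule card_subgroup_dvd) simp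
  then obtain m where m: "card H = card (H \<inter> fit) * m"
    by (rule dvdE)
  have "H \<inter> fit \<subset> H"
    using H unfolding outer_def by blast
  then have "card (H \<inter> fit) < card H"
    using finite_subgroup[OF HG] by (intro psubset_card_mono)
  with m have "2 \<le> m"
    by (cases m) auto
  then have "2 * card (H \<inter> fit) \<le> card H"
    using m by simp
  moreover have "card H = card (H \<inter> fit) + card (H - fit)"
    using card_Int_Diff[of H fit] finite_subgroup[OF HG] by simp
  ultimately have "card H \<le> 2 * card (H - fit)"
    by simp
  then have "card H * card (carrier G) \<le> 2 * (card (carrier G) * card (H - fit))"
    by (metis mult.assoc mult.commute mult_le_mono1)
  then have "card H * card (carrier G) \<le> card H * (2 * card (sweep H))"
    unfolding card_sweep[OF H] by (simp add: mult.left_commute)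
  then show ?thesis
    using card_subgroup_pos[OF HG] by simp
qed

text \<open>Disjoint sweeps would together have at least |G| elements, yet both avoid the identity,
  which lies in \<open>fit\<close>.\<close>

lemma outer_conjugate:
  assumes H: "outer H" and K: "outer K"
  obtains g where "g \<in> carrier G" "conjugate G g H = K"
proof (cases "sweep H \<inter> sweep K = {}")
  case True
  have "finite (carrier G - fit)"
    using finite_carrier by simp
  note fin = finite_subset[OF sweep_subset[OF H] this] finite_subset[OF sweep_subset[OF K] this]
  have "fit \<noteq> {}"
    using subgroup.one_closed[OF fitting_subgroup_subgroup] by blast
  then have "carrier G - fit \<subset> carrier G"
    using subgroup.subset[OF fitting_subgroup_subgroup] by blast
  then have "sweep H \<union> sweep K \<subset> carrier G"
    using sweep_subset[OF H] sweep_subset[OF K] by blast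
  then have "card (sweep H \<union> sweep K) < card (carrier G)"
    using finite_carrier by (intro psubset_card_mono)
  then have "card (sweep H) + card (sweep K) < card (carrier G)"
    using card_Un_disjoint[OF fin True] by simp
  with card_le_twice_sweep[OF H] card_le_twice_sweep[OF K] show ?thesis
    by linarith
next
  case False
  then obtain x h z k where "x \<in> carrier G" "h \<in> H" "h \<notin> fit" "z \<in> carrier G" "k \<in> K"
    "x \<otimes> h \<otimes> inv x = z \<otimes> k \<otimes> inv z"
    unfolding sweep_def by auto
  then show ?thesis
    using conjugates_of_outer_meet[OF H K] that by (metis inv_closed m_closed)
qed

text \<open>An element outside \<open>fit\<close> lies in some outer subgroup through the cyclic
  group it generates, and that subgroup is conjugate to \<open>H\<close>.\<close>

lemma sweep_eq:
  assumes H: "outer H"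
  shows "sweep H = carrier G - fit"
proof (rule subset_antisym[OF sweep_subset[OF H]], rule subsetI)
  fix y assume y: "y \<in> carrier G - fit"
  then have "y \<in> generate G {y}" "nilpotent_subgroup (generate G {y}) G"
    using cyclic_subgroup_nilpotent by (auto intro: generate.incl)
  with y obtain K where K: "outer K" "y \<in> K"
    using nilpotent_subset_outer[of "generate G {y}"] by blast
  obtain g where g: "g \<in> carrier G" "conjugate G g H = K"
    using outer_conjugate[OF H K(1)] .
  then obtain h where h: "h \<in> H" "y = g \<otimes> h \<otimes> inv g"
    using K(2) unfolding conjugate_def by blast
  have "h \<in> carrier G"
    using outer_subgroup[OF H] h(1) by (rule subgroup.mem_carrier)
  then have "h \<notin> fit"
    using y g(1) h(2) conjugate_mem_fit_iff by simp
  with g(1) h show "y \<in> sweep H"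
    unfolding sweep_def by (intro image_eqI[of _ _ "(g, h)"]) simp_all
qed

lemma fit_mult_outer:
  assumes H: "outer H"
  shows "fit <#> H = carrier G"
proof -
  have HG: "subgroup H G"
    using H by (rule outer_subgroup)
  note F = fitting_subgroup_subgroup
  have Fc: "fit \<subseteq> carrier G"
    using subgroup.subset[OF F] .
  have "card H = card (fit \<inter> H) + card (H - fit)"
    using card_Int_Diff[of H fit] finite_subgroup[OF HG] by (simp add: Int_commute)
  moreover have "card (carrier G) = card fit + card (carrier G - fit)"
    using card_Int_Diff[of "carrier G" fit] finite_carrier Fc by (simp add: Int_absorb1)
  moreover have "card (carrier G) * card (H - fit) = card H * card (carrier G - fit)"
    using card_sweep[OF H] unfolding sweep_eq[OF H] .
  \<comment> \<open>Expand \<open>c * h\<close> both ways, as \<open>c * k + c * m\<close> and as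
    \<open>h * f + h * n\<close>, and cancel. Here \<open>c\<close>, \<open>h\<close>,
    \<open>f\<close> are the orders of \<open>G\<close>, \<open>H\<close>, \<open>fit\<close>, and
    \<open>k\<close> is that of \<open>fit \<inter> H\<close>.\<close>
  moreover have "c * k = h * f" if "h = k + m" "c = f + n" "c * m = h * n" for c h k m f n :: nat
    using that by (simp add: algebra_simps)
  ultimately have "card (carrier G) * card (fit \<inter> H) = card H * card fit"
    by blast
  also have "\<dots> = card (fit \<inter> H) * card (fit <#> H)"
    using card_set_mult[OF F HG finite_carrier] by (simp add: mult.commute)
  finally have "card (carrier G) = card (fit <#> H)"
    using card_subgroup_pos[OF subgroup_Int[OF F HG]] by simp
  moreover have "fit <#> H \<subseteq> carrier G"
    using set_mult_closed[OF Fc subgroup.subset[OF HG]] .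
  ultimately show ?thesis
    using card_subset_eq[OF finite_carrier] by simp
qed

text \<open>A larger nilpotent subgroup would lie in an outer \<open>M\<close> containing
  \<open>fit\<close>. Then \<open>M = fit <#> M\<close> is the whole group, so the whole group is
  nilpotent and lies in \<open>fit\<close>, a contradiction.\<close>

lemma fit_maximal_nilpotent: "maximal_nilpotent_subgroup fit G"
  unfolding maximal_nilpotent_subgroup_def
proof (intro conjI allI impI fitting_nilpotent)
  fix B assume B: "nilpotent_subgroup B G" "fit \<subseteq> B"
  show "B = fit"
  proof (rule ccontr)
    assume "B \<noteq> fit"
    then obtain M where M: "outer M" "B \<subseteq> M"
      using nilpotent_subset_outer[OF B(1)] B(2) by blast
    have MG: "subgroup M G"
      using M(1) by (rule outer_subgroup)
    have "fit <#> M \<subseteq> M"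
      unfolding set_mult_def using B(2) M(2) subgroup.m_closed[OF MG] by blast
    then have "M = carrier G"
      using fit_mult_outer[OF M(1)] subgroup.subset[OF MG] by simp
    then have "M \<subseteq> fit"
      using nilpotent_normal_subset_fitting[OF _ outer_nilpotent[OF M(1)]] normal_self by simp
    with M(1) show False
      unfolding outer_def by blast
  qed
qed

text \<open>\<open>P\<close> is normal in the nilpotent group \<open>fit\<close>, hence subnormal in
  \<open>G\<close>, hence equal to the p-core.\<close>

lemma sylow_subset_fit_normal:
  assumes p: "Factorial_Ring.prime p" and P: "sylow_subgroup p P G" and "P \<subseteq> fit"
  shows "P \<lhd> G"
proof -
  have "P \<lhd> G\<lparr>carrier := fit\<rparr>"
    using nilpotent_subgroup_sylow_normal[OF fitting_nilpotent p
        sylow_of_subgroup[OF p P fitting_subgroup_subgroup \<open>P \<subseteq> fit\<close>]] .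
  then have "subnormal_subgroup P G"
    by (rule subnormal_subgroup.step[OF normal_imp_subnormal[OF fitting_normal]])
  then have "P \<subseteq> p_core G p"
    using P unfolding sylow_subgroup_def by (intro subnormal_p_subgroup_subset_p_core[OF p]) blast+
  then have "P = p_core G p"
    using p_core_subset_sylow[OF P] by blast
  then show ?thesis
    using p_core_normal[OF p] by simp
qed

lemma sylow_nilpotent:
  "Factorial_Ring.prime p \<Longrightarrow> sylow_subgroup p P G \<Longrightarrow> nilpotent_subgroup P G"
  unfolding sylow_subgroup_def using p_subgroup_nilpotent by blast

lemma normalizer_sylow_carter:
  assumes p: "Factorial_Ring.prime p" and P: "sylow_subgroup p P G" and "\<not> P \<lhd> G"
  shows "carter_subgroup (normalizer G P) G"
  unfolding carter_subgroup_def
  using normalizer_nilpotent[OF sylow_nilpotent[OF p P]] sylow_subset_fit_normal[OF p P] assms(3)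
    normalizer_sylow_self_normalizing[OF p P] by blast

text \<open>Merges the two cases: \<open>fit\<close> serves as \<open>H\<close> when it is the whole
  group, and any outer subgroup serves otherwise. In the latter case each non-normal Sylow subgroup
  is moved into \<open>H\<close> by its own conjugation, which is harmless because one may be picked
  for each prime separately.\<close>

lemma exists_nilpotent_supplement:
  obtains H where "nilpotent_subgroup H G" "fit <#> H = carrier G"
    "\<And>p. Factorial_Ring.prime p \<Longrightarrow> \<exists>P. sylow_subgroup p P G \<and> (P \<lhd> G \<or> P \<subseteq> H)"
proof (cases "fit = carrier G")
  case True
  have "\<exists>P. sylow_subgroup p P G \<and> (P \<lhd> G \<or> P \<subseteq> fit)" if "Factorial_Ring.prime p" for p
    using sylow_exists[OF that] subgroup.subset unfolding True sylow_subgroup_def by blast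
  moreover have "fit <#> fit = carrier G"
    using set_mult_carrier_idem[OF subgroup_self] unfolding True by simp
  ultimately show ?thesis
    using that fitting_nilpotent by blast
next
  case False
  then obtain y where y: "y \<in> carrier G" "y \<notin> fit"
    using subgroup.subset[OF fitting_subgroup_subgroup] by blast
  moreover have "y \<in> generate G {y}"
    by (rule generate.incl) simp
  ultimately obtain H where H: "outer H"
    using nilpotent_subset_outer[OF cyclic_subgroup_nilpotent[OF y(1)]] by blast
  have "\<exists>P. sylow_subgroup p P G \<and> (P \<lhd> G \<or> P \<subseteq> H)" if p: "Factorial_Ring.prime p" for p
  proof -
    obtain P where P: "sylow_subgroup p P G"
      using sylow_exists[OF p] by blast
    show ?thesis
    proof (cases "P \<lhd> G")
      case True
      with P show ?thesis by blast
    next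
      case False
      then have "\<not> P \<subseteq> fit"
        using sylow_subset_fit_normal[OF p P] by blast
      then obtain K where K: "outer K" "P \<subseteq> K"
        by (rule nilpotent_subset_outer[OF sylow_nilpotent[OF p P]])
      obtain g where g: "g \<in> carrier G" "conjugate G g K = H"
        using outer_conjugate[OF K(1) H] .
      have "sylow_subgroup p (conjugate G g P) G" "conjugate G g P \<subseteq> H"
        using conjugate_sylow[OF g(1) P] conjugate_mono[OF K(2), of g] g(2) by simp_all
      then show ?thesis by blast
    qed
  qed
  with outer_nilpotent[OF H] fit_mult_outer[OF H] show ?thesis
    by (rule that)
qed

end

subsection \<open>Products of Sylow subgroups\<close>

context finite_group
begin

text \<open>Adding one factor multiplies the order by at most a divisor of
  \<open>card (P i)\<close>, by the product formula. Divisibility is all that the coprimality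
  argument for direct products asks for.\<close>

lemma generate_normals_dvd_prod:
  assumes H: "subgroup H G" and fin: "finite I" and N: "\<And>i. i \<in> I \<Longrightarrow> P i \<lhd> G\<lparr>carrier := H\<rparr>"
  shows "card (generate G (\<Union>i\<in>I. P i)) dvd (\<Prod>i\<in>I. card (P i))"
  using fin N
proof (induction I)
  case empty
  then show ?case by (simp add: generate_empty)
next
  case (insert i I)
  let ?W = "generate G (\<Union>i\<in>I. P i)"
  interpret H: group "G\<lparr>carrier := H\<rparr>"
    using H by (rule subgroup_imp_group)
  have Psub: "subgroup (P j) G \<and> P j \<subseteq> H" if "j \<in> insert i I" for j
    using insert.prems[OF that] unfolding normal_restrict_iff[OF H] by blast
  then have PH: "(\<Union>i\<in>I. P i) \<subseteq> H" by blast
  have W: "subgroup ?W G"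
    using PH subgroup.subset[OF H] by (intro generate_is_subgroup) blast
  have WH: "?W \<subseteq> H"
    using PH H by (rule generate_subgroup_incl)
  \<comment> \<open>\<open>P i\<close> is only assumed normal in \<open>H\<close>, so the product is
    recognized as a subgroup there and then lifted to \<open>G\<close>.\<close>
  have "subgroup (P i <#>\<^bsub>G\<lparr>carrier := H\<rparr>\<^esub> ?W) (G\<lparr>carrier := H\<rparr>)"
    using insert.prems[of i] W WH subgroup_restrict_iff[OF H]
    by (intro H.normal_set_mult_subgroup) simp_all
  then have PW: "subgroup (P i <#> ?W) G"
    unfolding set_mult_consistent using incl_subgroup[OF H] by blast
  have Pi: "subgroup (P i) G"
    using Psub by simp
  have "(\<Union>j\<in>I. P j) \<subseteq> ?W"
    by (intro subsetI generate.incl)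
  then have "(\<Union>j\<in>insert i I. P j) \<subseteq> P i <#> ?W"
    using subset_set_mult[OF Pi W] by blast
  then have le: "generate G (\<Union>j\<in>insert i I. P j) \<subseteq> P i <#> ?W"
    using PW by (rule generate_subgroup_incl)
  have "(\<Union>j\<in>insert i I. P j) \<subseteq> carrier G"
    using Psub subgroup.subset[OF H] by blast
  then have "card (generate G (\<Union>j\<in>insert i I. P j)) dvd card (P i <#> ?W)"
    by (intro card_subgroup_dvd[OF generate_is_subgroup PW le])
  also have "\<dots> dvd card (P i) * card ?W"
    unfolding card_set_mult[OF Pi W finite_carrier] by simp
  also have "\<dots> dvd card (P i) * (\<Prod>i\<in>I. card (P i))"
    using insert.IH insert.prems by (intro mult_dvd_mono) simp_all
  finally show ?case
    using insert.hyps by simp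
qed

text \<open>Normality in the ambient \<open>H\<close> passes to the generated subgroup, and the
  intersections are trivial because the other factors generate a group of order prime to
  \<open>card (P i)\<close>.\<close>

lemma internal_direct_product_coprime:
  assumes H: "subgroup H G" and fin: "finite I" and N: "\<And>i. i \<in> I \<Longrightarrow> P i \<lhd> G\<lparr>carrier := H\<rparr>"
    and cop: "\<And>i j. i \<in> I \<Longrightarrow> j \<in> I \<Longrightarrow> i \<noteq> j \<Longrightarrow> coprime (card (P i)) (card (P j))"
  shows "internal_direct_product (generate G (\<Union>i\<in>I. P i)) I P G"
proof -
  let ?D = "generate G (\<Union>i\<in>I. P i)"
  have P: "subgroup (P i) G" "P i \<subseteq> H" "\<And>g. g \<in> H \<Longrightarrow> conjugate G g (P i) \<subseteq> P i"
    if "i \<in> I" for i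
    using N[OF that] unfolding normal_restrict_iff[OF H] by blast+
  have sub: "(\<Union>i\<in>J. P i) \<subseteq> carrier G" if "J \<subseteq> I" for J
    using that P(2) subgroup.subset[OF H] by blast
  have D: "subgroup ?D G"
    by (rule generate_is_subgroup[OF sub[OF subset_refl]])
  have DH: "?D \<subseteq> H"
    using P(2) by (intro generate_subgroup_incl[OF _ H]) blast
  have "P i \<lhd> G\<lparr>carrier := ?D\<rparr>" if i: "i \<in> I" for i
  proof -
    have "P i \<subseteq> ?D"
      using i by (intro subsetI generate.incl) blast
    then show ?thesis
      unfolding normal_restrict_iff[OF D] using P(1,3)[OF i] DH by blast
  qed
  moreover have "P i \<inter> generate G (\<Union>j\<in>I - {i}. P j) = {\<one>}" if i: "i \<in> I" for i
  proof (rule Int_eq_one_of_coprime[OF P(1)[OF i]])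
    show "subgroup (generate G (\<Union>j\<in>I - {i}. P j)) G"
      by (rule generate_is_subgroup[OF sub]) blast
    have "coprime (card (P i)) (\<Prod>j\<in>I - {i}. card (P j))"
      by (intro prod_coprime_right cop[OF i]) auto
    moreover have "card (generate G (\<Union>j\<in>I - {i}. P j)) dvd (\<Prod>j\<in>I - {i}. card (P j))"
      using fin N by (intro generate_normals_dvd_prod[OF H]) simp_all
    ultimately show "coprime (card (P i)) (card (generate G (\<Union>j\<in>I - {i}. P j)))"
      by (rule coprime_divisors[OF dvd_refl, rotated])
  qed
  ultimately show ?thesis
    unfolding internal_direct_product_def by blast
qed

lemma prod_upto_normal:
  assumes "\<And>i. i \<in> {1..n} \<Longrightarrow> P i \<lhd> G"
  shows "prod_upto G P n \<lhd> G"
  using assms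
proof (induction n)
  case (Suc n)
  then show ?case
    by (simp add: normal_subgroup_set_mult_closed)
qed (simp add: one_is_normal)

lemma subset_prod_upto:
  assumes "\<And>i. i \<in> {1..n} \<Longrightarrow> P i \<lhd> G" "i \<in> {1..n}"
  shows "P i \<subseteq> prod_upto G P n"
  using assms
proof (induction n)
  case (Suc n)
  have "prod_upto G P n \<lhd> G"
    using Suc.prems(1) by (intro prod_upto_normal) simp
  then have subs: "prod_upto G P n \<subseteq> prod_upto G P (Suc n)" "P (Suc n) \<subseteq> prod_upto G P (Suc n)"
    using subset_set_mult Suc.prems(1)[of "Suc n"] by (simp_all add: normal_imp_subgroup)
  show ?case
  proof (cases "i = Suc n")
    case True
    with subs(2) show ?thesis by simp
  next
    case False
    with Suc.prems have "P i \<subseteq> prod_upto G P n"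
      by (intro Suc.IH) simp_all
    with subs(1) show ?thesis by blast
  qed
qed simp

lemma prod_upto_subset:
  assumes "subgroup S G" "\<And>i. i \<in> {1..n} \<Longrightarrow> P i \<subseteq> S"
  shows "prod_upto G P n \<subseteq> S"
  using assms(2)
proof (induction n)
  case (Suc n)
  then have "prod_upto G P n \<subseteq> S" "P (Suc n) \<subseteq> S" by simp_all
  then show ?case
    unfolding prod_upto.simps set_mult_def using subgroup.m_closed[OF assms(1)] by blast
qed (simp add: subgroup.one_closed[OF assms(1)])

text \<open>The divisibility assumption excludes the trivial subgroup, which is Sylow for every
  prime not dividing the order.\<close>

lemma sylow_prime_unique:
  assumes p: "Factorial_Ring.prime p" and q: "Factorial_Ring.prime q" and dvd: "p dvd order G"
    and P: "sylow_subgroup p P G" "sylow_subgroup q P G"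
  shows "p = q"
proof -
  have "multiplicity p (order G) \<noteq> 0"
    using dvd p order_pos by (simp add: prime_multiplicity_gt_zero_iff)
  then have "p dvd p ^ multiplicity p (order G)"
    by simp
  also have "\<dots> = q ^ multiplicity q (order G)"
    using P unfolding sylow_subgroup_def by simp
  finally have "p dvd q"
    using p prime_dvd_power_nat by blast
  then show ?thesis
    using p q primes_dvd_imp_eq by blast
qed

lemma sylow_nontrivial:
  assumes p: "Factorial_Ring.prime p" and dvd: "p dvd order G"
  shows "\<not> sylow_subgroup p {\<one>} G"
proof
  assume "sylow_subgroup p {\<one>} G"
  then have "p ^ multiplicity p (order G) = 1"
    unfolding sylow_subgroup_def by simp
  moreover have "multiplicity p (order G) \<noteq> 0"
    using dvd p order_pos by (simp add: prime_multiplicity_gt_zero_iff)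
  ultimately show False
    using prime_gt_1_nat[OF p] by simp
qed

lemma sylow_trivial:
  assumes "\<not> p dvd order G" "sylow_subgroup p P G"
  shows "P = {\<one>}"
proof -
  have "card P = 1" and P: "subgroup P G"
    using assms unfolding sylow_subgroup_def by (simp_all add: not_dvd_imp_multiplicity_0)
  then obtain x where "P = {x}"
    by (metis card_1_singletonE)
  then show ?thesis
    using subgroup.one_closed[OF P] by simp
qed

end

text \<open>Lists \<open>A\<close> before \<open>B\<close>, counting from 1; this will put the
  normal members of the Sylow set first and make \<open>r\<close> the number of them.\<close>

lemma enumerate_disjoint:
  assumes "finite A" "finite B" "A \<inter> B = {}"
  obtains P :: "nat \<Rightarrow> 'a" where "bij_betw P {1..card A} A" "bij_betw P {card A + 1..card A + card B} B"
    "inj_on P {1..card A + card B}" "P ` {1..card A + card B} = A \<union> B"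
proof -
  obtain f g where f: "bij_betw f {1..card A} A" and g: "bij_betw g {1..card B} B"
    using ex_bij_betw_nat_finite_1[OF assms(1)] ex_bij_betw_nat_finite_1[OF assms(2)] by blast
  define P where "P i = (if i \<le> card A then f i else g (i - card A))" for i
  have fP: "bij_betw P {1..card A} A"
    using f by (subst bij_betw_cong[of _ _ f]) (simp_all add: P_def)
  have "bij_betw (\<lambda>i. i - card A) {card A + 1..card A + card B} {1..card B}"
    by (rule bij_betw_byWitness[where f' = "\<lambda>i. i + card A"]) auto
  then have "bij_betw (g \<circ> (\<lambda>i. i - card A)) {card A + 1..card A + card B} B"
    using g by (rule bij_betw_trans)
  then have gP: "bij_betw P {card A + 1..card A + card B} B"
    by (subst bij_betw_cong[of _ _ "g \<circ> (\<lambda>i. i - card A)"]) (simp_all add: P_def)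
  have "{1..card A} \<union> {card A + 1..card A + card B} = {1..card A + card B}"
    by auto
  then have P: "bij_betw P {1..card A + card B} (A \<union> B)"
    using bij_betw_combine[OF fP gP assms(3)] by simp
  show ?thesis
    by (rule that[OF fP gP bij_betw_imp_inj_on[OF P] bij_betw_imp_surj_on[OF P]])
qed

section \<open>The Sylow family and the three claims\<close>

theorem corollary1p4:
  fixes G :: "('a, 'b) monoid_scheme"
  assumes "group G" and "finite (carrier G)" and "weakly_semi_nilpotent G"
  shows "\<exists>(P :: nat \<Rightarrow> 'a set) (t :: nat) (r :: nat).
    (inj_on P {1..t} \<and> complete_sylow_set (P ` {1..t}) G \<and> 1 \<le> r \<and> r \<le> t \<and>
      (\<forall>i\<in>{1..r}. P i \<lhd> G) \<and>
      (\<forall>i\<in>{r+1..t}. \<not> P i \<lhd> G) \<and>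
      internal_direct_product (generate G (\<Union>i\<in>{r+1..t}. P i)) {r+1..t} P G) \<and>
    (maximal_nilpotent_subgroup (fitting_subgroup G) G \<and>
      fitting_subgroup G = prod_upto G P r <#>\<^bsub>G\<^esub> hypercentre G) \<and>
    (\<not> nilpotent_group G \<longrightarrow>
      (\<forall>i\<in>{r+1..t}. carter_subgroup (normalizer G (P i)) G))"
proof -
  interpret wsn_group G
    using assms by (simp add: wsn_group_def wsn_group_axioms_def finite_group_def finite_group_axioms_def)
  obtain H where H: "nilpotent_subgroup H G" and FH: "fit <#>\<^bsub>G\<^esub> H = carrier G"
    and "\<And>p. Factorial_Ring.prime p \<Longrightarrow> \<exists>P. sylow_subgroup p P G \<and> (P \<lhd> G \<or> P \<subseteq> H)"
    using exists_nilpotent_supplement by blast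
  \<comment> \<open>One Sylow subgroup is chosen for every prime, including primes not dividing the
    order, where it is trivial.\<close>
  then obtain S where S: "\<And>p. Factorial_Ring.prime p \<Longrightarrow> sylow_subgroup p (S p) G"
    and S_cases: "\<And>p. Factorial_Ring.prime p \<Longrightarrow> S p \<lhd> G \<or> S p \<subseteq> H"
    by metis
  have HG: "subgroup H G"
    using H unfolding nilpotent_subgroup_def by blast
  define pr where "pr = {p. Factorial_Ring.prime p \<and> p dvd order G}"
  have fin: "finite pr"
    using finite_divisors_nat[of "order G"] order_pos unfolding pr_def by simp
  \<comment> \<open>The condition \<open>1 \<le> r\<close> asks for at least one normal member. If
    no Sylow subgroup for a prime divisor is normal, the trivial subgroup fills the place.\<close>
  define \<A> where "\<A> = (if {p \<in> pr. S p \<lhd> G} = {} then {{\<one>\<^bsub>G\<^esub>}} else S ` {p \<in> pr. S p \<lhd> G})"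
  define \<B> where "\<B> = S ` {p \<in> pr. \<not> S p \<lhd> G}"
  have \<A>_cases: "Q = {\<one>\<^bsub>G\<^esub>} \<or> (\<exists>p\<in>pr. Q = S p)" if "Q \<in> \<A>" for Q
    using that unfolding \<A>_def by (auto split: if_splits)
  have \<A>_normal: "Q \<lhd> G" if "Q \<in> \<A>" for Q
    using that one_is_normal unfolding \<A>_def by (auto split: if_splits)
  have S_\<A>: "S p \<in> \<A>" if "p \<in> pr" "S p \<lhd> G" for p
    using that unfolding \<A>_def by auto
  have \<B>_cases: "\<exists>p. Factorial_Ring.prime p \<and> p dvd order G \<and> Q = S p \<and> \<not> S p \<lhd> G" if "Q \<in> \<B>" for Q
    using that unfolding \<B>_def pr_def by blast
  have finA: "finite \<A>" and finB: "finite \<B>" and neA: "\<A> \<noteq> {}"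
    using fin unfolding \<A>_def \<B>_def by auto
  have disj: "\<A> \<inter> \<B> = {}"
    using \<A>_normal \<B>_cases by blast
  define r where "r = card \<A>"
  define t where "t = card \<A> + card \<B>"
  obtain P :: "nat \<Rightarrow> 'a set" where PA: "bij_betw P {1..r} \<A>" and PB: "bij_betw P {r+1..t} \<B>"
    and inj: "inj_on P {1..t}" and img: "P ` {1..t} = \<A> \<union> \<B>"
    using enumerate_disjoint[OF finA finB disj] unfolding r_def t_def by blast
  have P_\<A>: "P i \<in> \<A>" if "i \<in> {1..r}" for i
    using PA that by (rule bij_betwE[THEN bspec])
  have P_\<B>: "P i \<in> \<B>" if "i \<in> {r+1..t}" for i
    using PB that by (rule bij_betwE[THEN bspec])
  have "1 \<le> r" "r \<le> t"
    using neA finA unfolding r_def t_def by (simp_all add: Suc_le_eq card_gt_0_iff)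
  have P_normal: "P i \<lhd> G" if "i \<in> {1..r}" for i
    using \<A>_normal[OF P_\<A>[OF that]] .
  have P_not_normal: "\<not> P i \<lhd> G" if "i \<in> {r+1..t}" for i
    using \<B>_cases[OF P_\<B>[OF that]] by metis

  have complete: "complete_sylow_set (\<A> \<union> \<B>) G"
  proof -
    have "Q = {\<one>\<^bsub>G\<^esub>} \<or> (\<exists>p. Factorial_Ring.prime p \<and> p dvd order G \<and> sylow_subgroup p Q G)"
      if "Q \<in> \<A> \<union> \<B>" for Q
      using that \<A>_cases \<B>_cases S unfolding pr_def by blast
    moreover have "\<exists>!Q. Q \<in> \<A> \<union> \<B> \<and> sylow_subgroup p Q G"
      if p: "Factorial_Ring.prime p" "p dvd order G" for p
    proof (rule ex1I[of _ "S p"])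
      have "p \<in> pr"
        using p unfolding pr_def by simp
      then have "S p \<in> \<A> \<union> \<B>"
        using S_\<A> unfolding \<B>_def by blast
      then show "S p \<in> \<A> \<union> \<B> \<and> sylow_subgroup p (S p) G"
        using S[OF p(1)] by blast
    next
      fix Q assume Q: "Q \<in> \<A> \<union> \<B> \<and> sylow_subgroup p Q G"
      \<comment> \<open>This discards the trivial filler.\<close>
      then have "Q \<noteq> {\<one>\<^bsub>G\<^esub>}"
        using sylow_nontrivial[OF p] by blast
      then obtain q where q: "Factorial_Ring.prime q" "Q = S q"
        using Q \<A>_cases \<B>_cases unfolding pr_def by blast
      then have "p = q"
        using sylow_prime_unique[OF p(1) q(1) p(2)] Q S[OF q(1)] by blast
      with q show "Q = S p" by simp
    qed
    ultimately show ?thesis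
      unfolding complete_sylow_set_def by blast
  qed

  have direct: "internal_direct_product (generate G (\<Union>i\<in>{r+1..t}. P i)) {r+1..t} P G"
  proof (rule internal_direct_product_coprime[OF HG])
    \<comment> \<open>A non-normal \<open>S p\<close> was chosen inside the nilpotent group
      \<open>H\<close>, where Sylow subgroups are normal.\<close>
    show "P i \<lhd> G\<lparr>carrier := H\<rparr>" if i: "i \<in> {r+1..t}" for i
    proof -
      obtain p where p: "Factorial_Ring.prime p" "P i = S p" "\<not> S p \<lhd> G"
        using \<B>_cases[OF P_\<B>[OF i]] by blast
      then have "S p \<subseteq> H"
        using S_cases by blast
      then show ?thesis
        unfolding p(2)
        by (rule nilpotent_subgroup_sylow_normal[OF H p(1) sylow_of_subgroup[OF p(1) S[OF p(1)] HG]])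
    qed
    show "coprime (card (P i)) (card (P j))" if ij: "i \<in> {r+1..t}" "j \<in> {r+1..t}" "i \<noteq> j" for i j
    proof -
      obtain p where p: "Factorial_Ring.prime p" "P i = S p"
        using \<B>_cases[OF P_\<B>[OF ij(1)]] by blast
      obtain q where q: "Factorial_Ring.prime q" "P j = S q"
        using \<B>_cases[OF P_\<B>[OF ij(2)]] by blast
      have "P i \<noteq> P j"
        using bij_betw_imp_inj_on[OF PB] ij by (meson inj_on_eq_iff)
      then have "coprime p q"
        using p q by (metis primes_coprime)
      then show ?thesis
        using S[OF p(1)] S[OF q(1)] unfolding p(2) q(2) sylow_subgroup_def by simp
    qed
  qed simp

  let ?N = "prod_upto G P r"
  have N: "?N \<lhd> G"
    using P_normal by (rule prod_upto_normal)
  note NZ = normal_subgroup_set_mult_closed[OF N hypercentre_normal, THEN normal_imp_subgroup]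
  note NZ_subs = subset_set_mult[OF normal_imp_subgroup[OF N] normal_imp_subgroup[OF hypercentre_normal]]
  have "fit \<subseteq> ?N <#>\<^bsub>G\<^esub> hypercentre G"
  proof (rule fitting_subset_if_p_cores_subset[OF NZ])
    fix p :: nat assume p: "Factorial_Ring.prime p"
    have core: "p_core G p \<subseteq> S p"
      by (rule p_core_subset_sylow[OF S[OF p]])
    \<comment> \<open>The p-core is trivial, or lies in one of the normal factors of
      \<open>?N\<close>, or lies in \<open>H\<close>; only in the last case is the hypercentre
      needed.\<close>
    consider "\<not> p dvd order G" | "p \<in> pr" "S p \<lhd> G" | "S p \<subseteq> H"
      using S_cases[OF p] p unfolding pr_def by blast
    then show "p_core G p \<subseteq> ?N <#>\<^bsub>G\<^esub> hypercentre G"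
    proof cases
      case 1
      then have "S p = {\<one>\<^bsub>G\<^esub>}"
        using S[OF p] by (rule sylow_trivial)
      then show ?thesis
        using core subgroup.one_closed[OF NZ] by auto
    next
      case 2
      then obtain i where i: "i \<in> {1..r}" "P i = S p"
        using S_\<A> bij_betw_imp_surj_on[OF PA] by (metis imageE)
      then have "S p \<subseteq> ?N"
        using subset_prod_upto[of r P i] P_normal by simp
      then show ?thesis
        using core NZ_subs(1) by blast
    next
      case 3
      let ?C = "{c \<in> carrier G. \<forall>k\<in>p_core G p. c \<otimes>\<^bsub>G\<^esub> k = k \<otimes>\<^bsub>G\<^esub> c}"
      have coreH: "p_core G p \<subseteq> H"
        using core 3 by blast
      have C: "?C \<lhd> G"
        by (rule centralizer_of_normal[OF p_core_normal[OF p]])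
      have CH: "subgroup (?C <#>\<^bsub>G\<^esub> H) G"
        using C HG by (rule normal_set_mult_subgroup)
      \<comment> \<open>\<open>G = F H\<close>, and \<open>F\<close> lies in the subgroup
        \<open>C H\<close>, which also contains \<open>H\<close>.\<close>
      have "carrier G \<subseteq> ?C <#>\<^bsub>G\<^esub> H"
      proof
        fix g assume "g \<in> carrier G"
        then obtain f h where "f \<in> fit" "h \<in> H" "g = f \<otimes>\<^bsub>G\<^esub> h"
          unfolding FH[symmetric] set_mult_def by blast
        then show "g \<in> ?C <#>\<^bsub>G\<^esub> H"
          using fitting_subset_centralizer_mult[OF p HG coreH]
            subset_set_mult(2)[OF normal_imp_subgroup[OF C] HG] subgroup.m_closed[OF CH] by blast
      qed
      from p_core_subset_hypercentre[OF p H coreH subgroup_self this]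
      have "p_core G p \<subseteq> hypercentre G"
        using subgroup.subset[OF p_core_subgroup[OF p]] by (simp add: Int_absorb2)
      then show ?thesis
        using NZ_subs(2) by blast
    qed
  qed
  moreover have "?N \<subseteq> fit"
  proof (rule prod_upto_subset[OF fitting_subgroup_subgroup])
    fix i assume i: "i \<in> {1..r}"
    have "P i = {\<one>\<^bsub>G\<^esub>} \<or> (\<exists>p. Factorial_Ring.prime p \<and> P i = S p)"
      using \<A>_cases[OF P_\<A>[OF i]] unfolding pr_def by blast
    then show "P i \<subseteq> fit"
    proof (elim disjE exE conjE)
      assume "P i = {\<one>\<^bsub>G\<^esub>}"
      then show ?thesis
        using subgroup.one_closed[OF fitting_subgroup_subgroup] by simp
    next
      fix p assume "Factorial_Ring.prime p" "P i = S p"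
      then show ?thesis
        using sylow_nilpotent S by (intro nilpotent_normal_subset_fitting[OF P_normal[OF i]]) simp
    qed
  qed
  then have "?N <#>\<^bsub>G\<^esub> hypercentre G \<subseteq> fit"
    using hypercentre_subset_fitting subgroup.m_closed[OF fitting_subgroup_subgroup]
    unfolding set_mult_def by blast
  ultimately have fit_eq: "fit = ?N <#>\<^bsub>G\<^esub> hypercentre G"
    by (rule subset_antisym)

  have carter: "carter_subgroup (normalizer G (P i)) G" if i: "i \<in> {r+1..t}" for i
  proof -
    obtain p where p: "Factorial_Ring.prime p" "P i = S p" "\<not> S p \<lhd> G"
      using \<B>_cases[OF P_\<B>[OF i]] by blast
    then show ?thesis
      using normalizer_sylow_carter[OF p(1) S[OF p(1)] p(3)] by simp
  qed
  show ?thesis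
    by (rule exI[of _ P], rule exI[of _ t], rule exI[of _ r], unfold img)
      (intro conjI impI ballI inj complete \<open>1 \<le> r\<close> \<open>r \<le> t\<close> P_normal P_not_normal direct
        fit_maximal_nilpotent fit_eq carter)
qed

end
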